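(* Let $\star_1$ and $\star_2$ be equivalent star products on a symplectic manifold $(M,\omega)$. 1. If $\mathrm C$ is a ${}^*$-structure for $\star_1$ and for $\star_2$, then $(C^\infty(M)[[\nu]],\star_1)$ and $(C^\infty(M)[[\nu]],\star_2)$ are equivalent as ${}^*$-algebras, i.e. there is an equivalence transformation $\mathcal S$ between them with $\mathrm C\mathcal S\mathrm C=\mathcal S$. 2. If $\star_1$ and $\star_2$ have the $\nu$-parity property, then they are $\mathrm P$-equivalent, i.e. there is an equivalence transformation $\mathcal S$ between them with $\mathrm P\mathcal S\mathrm P=\mathcal S$. 3. If $\star_1$ and $\star_2$ are of Weyl type, then they are Weyl-equivalent, i.e. there is an equivalence transformation $\mathcal S$ between them with $\mathrm C\mathcal S\mathrm C=\mathcal S$ and $\mathrm P\mathcal S\mathrm P=\mathcal S$.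
   Context: $\nu$ is a formal parameter. A star product for $(M,\omega)$ is a $\mathbb C[[\nu]]$-bilinear associative product $f\star g=\sum_{i\ge0}\nu^iC_i(f,g)$ on $C^\infty(M)[[\nu]]$ (complex-valued functions) with bidifferential $C_i$, $C_0(f,g)=fg$ and $C_1(f,g)-C_1(g,f)=\{f,g\}$, the Poisson bracket of $\omega$. An equivalence transformation between $\star_1$ and $\star_2$ is a $\mathbb C[[\nu]]$-linear map $\mathcal S=\mathrm{id}+\sum_{i\ge1}\nu^iS_i$ with differential operators $S_i$ on $C^\infty(M)$ such that $\mathcal S(f\star_1g)=(\mathcal Sf)\star_2(\mathcal Sg)$ for all $f,g\in C^\infty(M)[[\nu]]$; $\star_1$ and $\star_2$ are equivalent if such an $\mathcal S$ exists. $\mathrm C$ denotes complex conjugation on $C^\infty(M)[[\nu]]$ extended by $\mathrm C\nu:=-\nu$; $\mathrm P:=(-1)^{\deg_\nu}$ ($\deg_\nu=\nu\partial_\nu$) replaces $\nu$ by $-\nu$. $\star$ has $\mathrm C$ as ${}^*$-structure if $\mathrm C((\mathrm Cf)\star(\mathrm Cg))=g\star f$ for all $f,g$; it has the $\nu$-parity property if $\mathrm P((\mathrm Pf)\star(\mathrm Pg))=g\star f$ for all $f,g$; it is of Weyl type if both hold. *)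

theory Defs
  imports
    "HOL-Analysis.Analysis"
    "HOL-Computational_Algebra.Formal_Power_Series"
    "HOL-Library.Function_Algebras"
begin

text \<open>
  A smooth manifold is the whole of a Hausdorff, second countable type \<open>'m\<close> together with
  an atlas of charts \<open>(U, \<phi>)\<close> into a Euclidean space \<open>'e\<close>, so manifolds here are
  nonempty and of positive dimension.  The atlas is not required to be
  maximal; none of the notions below depends on which atlas of a given smooth structure is used.
  Function spaces carry the pointwise operations of \<open>Function_Algebras\<close>.
\<close>

section \<open>Smooth functions on open subsets of Euclidean space\<close>

text \<open>Iterated partial derivatives; a list of basis vectors takes the place of a multi-index.\<close>

primrec iter_partial ::
  "'e::euclidean_space list \<Rightarrow> ('e \<Rightarrow> 'b::real_normed_vector) \<Rightarrow> 'e \<Rightarrow> 'b" where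
  "iter_partial [] F = F"
| "iter_partial (b # bs) F = (\<lambda>x. frechet_derivative (iter_partial bs F) (at x) b)"

definition smooth_on :: "'e::euclidean_space set \<Rightarrow> ('e \<Rightarrow> 'b::real_normed_vector) \<Rightarrow> bool" where
  "smooth_on X F \<longleftrightarrow>
     open X \<and> (\<forall>bs. set bs \<subseteq> Basis \<longrightarrow> (\<forall>x\<in>X. iter_partial bs F differentiable (at x)))"

section \<open>Smooth manifolds\<close>

type_synonym ('m, 'e) chart = "'m set \<times> ('m \<Rightarrow> 'e)"

definition chart_inv :: "('m, 'e) chart \<Rightarrow> 'e \<Rightarrow> 'm" where
  "chart_inv c = inv_into (fst c) (snd c)"

definition chart_image :: "('m, 'e) chart \<Rightarrow> 'e set" where
  "chart_image c = snd c ` fst c"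

definition smooth_atlas ::
  "('m::{t2_space,second_countable_topology}, 'e::euclidean_space) chart set \<Rightarrow> bool" where
  "smooth_atlas A \<longleftrightarrow>
     (\<Union>c\<in>A. fst c) = UNIV \<and>
     (\<forall>c\<in>A. open (fst c) \<and> open (chart_image c) \<and>
        homeomorphism (fst c) (chart_image c) (snd c) (chart_inv c)) \<and>
     (\<forall>c\<in>A. \<forall>d\<in>A. smooth_on (snd c ` (fst c \<inter> fst d)) (snd d \<circ> chart_inv c))"

definition smooth_functions ::
  "('m, 'e::euclidean_space) chart set \<Rightarrow> ('m \<Rightarrow> 'b::real_normed_vector) set" where
  "smooth_functions A = {f. \<forall>c\<in>A. smooth_on (chart_image c) (f \<circ> chart_inv c)}"

text \<open>Tangent vectors are point derivations on real-valued smooth functions.  The first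
  condition fixes their value on non-smooth functions, so that two tangent vectors are equal
  as soon as they agree on smooth functions.\<close>

definition tangent_space ::
  "('m, 'e::euclidean_space) chart set \<Rightarrow> 'm \<Rightarrow> (('m \<Rightarrow> real) \<Rightarrow> real) set" where
  "tangent_space A p = {v.
     (\<forall>f. f \<notin> smooth_functions A \<longrightarrow> v f = 0) \<and>
     (\<forall>f\<in>smooth_functions A. \<forall>g\<in>smooth_functions A. v (f + g) = v f + v g) \<and>
     (\<forall>r. \<forall>f\<in>smooth_functions A. v (\<lambda>q. r * f q) = r * v f) \<and>
     (\<forall>f\<in>smooth_functions A. \<forall>g\<in>smooth_functions A. v (f * g) = f p * v g + g p * v f)}"

definition coord_vector ::
  "('m, 'e::euclidean_space) chart set \<Rightarrow> ('m, 'e) chart \<Rightarrow> 'e \<Rightarrow> 'm \<Rightarrow> ('m \<Rightarrow> real) \<Rightarrow> real" where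
  "coord_vector A c b p f =
     (if f \<in> smooth_functions A then iter_partial [b] (f \<circ> chart_inv c) (snd c p) else 0)"

section \<open>Symplectic manifolds and the Poisson bracket\<close>

type_synonym 'm two_form = "'m \<Rightarrow> (('m \<Rightarrow> real) \<Rightarrow> real) \<Rightarrow> (('m \<Rightarrow> real) \<Rightarrow> real) \<Rightarrow> real"

definition form_coeff ::
  "('m, 'e::euclidean_space) chart set \<Rightarrow> 'm two_form \<Rightarrow> ('m, 'e) chart \<Rightarrow> 'e \<Rightarrow> 'e \<Rightarrow> 'e \<Rightarrow> real" where
  "form_coeff A \<omega> c b b' x =
     (let p = chart_inv c x in \<omega> p (coord_vector A c b p) (coord_vector A c b' p))"

definition differential_two_form ::
  "('m, 'e::euclidean_space) chart set \<Rightarrow> 'm two_form \<Rightarrow> bool" where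
  "differential_two_form A \<omega> \<longleftrightarrow>
     (\<forall>p. \<forall>u\<in>tangent_space A p. \<forall>v\<in>tangent_space A p. \<forall>w\<in>tangent_space A p.
        \<omega> p (u + v) w = \<omega> p u w + \<omega> p v w \<and> \<omega> p w (u + v) = \<omega> p w u + \<omega> p w v) \<and>
     (\<forall>p r. \<forall>v\<in>tangent_space A p. \<forall>w\<in>tangent_space A p.
        \<omega> p (\<lambda>f. r * v f) w = r * \<omega> p v w \<and> \<omega> p w (\<lambda>f. r * v f) = r * \<omega> p w v) \<and>
     (\<forall>p. \<forall>v\<in>tangent_space A p. \<omega> p v v = 0) \<and>
     (\<forall>c\<in>A. \<forall>b\<in>Basis. \<forall>b'\<in>Basis. smooth_on (chart_image c) (form_coeff A \<omega> c b b'))"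

definition closed_form ::
  "('m, 'e::euclidean_space) chart set \<Rightarrow> 'm two_form \<Rightarrow> bool" where
  "closed_form A \<omega> \<longleftrightarrow>
     (\<forall>c\<in>A. \<forall>i\<in>Basis. \<forall>j\<in>Basis. \<forall>k\<in>Basis. \<forall>x\<in>chart_image c.
        iter_partial [i] (form_coeff A \<omega> c j k) x + iter_partial [j] (form_coeff A \<omega> c k i) x
        + iter_partial [k] (form_coeff A \<omega> c i j) x = 0)"

definition nondegenerate_form ::
  "('m, 'e::euclidean_space) chart set \<Rightarrow> 'm two_form \<Rightarrow> bool" where
  "nondegenerate_form A \<omega> \<longleftrightarrow>
     (\<forall>p. \<forall>v\<in>tangent_space A p. (\<forall>w\<in>tangent_space A p. \<omega> p v w = 0) \<longrightarrow> v = 0)"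

definition symplectic_manifold ::
  "('m::{t2_space,second_countable_topology}, 'e::euclidean_space) chart set \<Rightarrow> 'm two_form \<Rightarrow> bool" where
  "symplectic_manifold A \<omega> \<longleftrightarrow>
     smooth_atlas A \<and> differential_two_form A \<omega> \<and> closed_form A \<omega> \<and> nondegenerate_form A \<omega>"

text \<open>Sign convention: \<open>\<omega>(X\<^sub>f, \<cdot>) = df\<close> and \<open>{f, g} = \<omega>(X\<^sub>f, X\<^sub>g)\<close>, hence \<open>{q, p} = 1\<close> for
  \<open>\<omega> = dq \<and> dp\<close>.  The bracket is extended complex-bilinearly to complex-valued functions.\<close>

definition hamiltonian_vector ::
  "('m, 'e::euclidean_space) chart set \<Rightarrow> 'm two_form \<Rightarrow> ('m \<Rightarrow> real) \<Rightarrow> 'm \<Rightarrow> ('m \<Rightarrow> real) \<Rightarrow> real" where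
  "hamiltonian_vector A \<omega> f p =
     (THE v. v \<in> tangent_space A p \<and> (\<forall>w\<in>tangent_space A p. \<omega> p v w = w f))"

definition poisson_real ::
  "('m, 'e::euclidean_space) chart set \<Rightarrow> 'm two_form \<Rightarrow> ('m \<Rightarrow> real) \<Rightarrow> ('m \<Rightarrow> real) \<Rightarrow> 'm \<Rightarrow> real" where
  "poisson_real A \<omega> f g p = \<omega> p (hamiltonian_vector A \<omega> f p) (hamiltonian_vector A \<omega> g p)"

definition poisson_bracket ::
  "('m, 'e::euclidean_space) chart set \<Rightarrow> 'm two_form \<Rightarrow> ('m \<Rightarrow> complex) \<Rightarrow> ('m \<Rightarrow> complex) \<Rightarrow> 'm \<Rightarrow> complex" where
  "poisson_bracket A \<omega> f g p =
     Complex (poisson_real A \<omega> (Re \<circ> f) (Re \<circ> g) p - poisson_real A \<omega> (Im \<circ> f) (Im \<circ> g) p)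
             (poisson_real A \<omega> (Re \<circ> f) (Im \<circ> g) p + poisson_real A \<omega> (Im \<circ> f) (Re \<circ> g) p)"

section \<open>Differential and bidifferential operators\<close>

text \<open>Operators of order at most \<open>k\<close> are given in each chart by a linear combination, with
  smooth coefficients, of iterated partial derivatives of order at most \<open>k\<close>; the order is
  uniform over the charts.  The lists count mixed partial derivatives with repetition, which
  yields the same operators as multi-indices do.  Only the values on smooth functions matter.\<close>

definition multi_indices :: "nat \<Rightarrow> 'e::euclidean_space list set" where
  "multi_indices k = {bs. set bs \<subseteq> Basis \<and> length bs \<le> k}"

definition differential_operator ::
  "('m, 'e::euclidean_space) chart set \<Rightarrow> (('m \<Rightarrow> complex) \<Rightarrow> 'm \<Rightarrow> complex) \<Rightarrow> bool" where
  "differential_operator A D \<longleftrightarrow>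
     (\<exists>k. \<forall>c\<in>A. \<exists>a. (\<forall>bs\<in>multi_indices k. smooth_on (chart_image c) (a bs)) \<and>
        (\<forall>f\<in>smooth_functions A. \<forall>p\<in>fst c.
           D f p = (\<Sum>bs\<in>multi_indices k.
             a bs (snd c p) * iter_partial bs (f \<circ> chart_inv c) (snd c p))))"

definition bidifferential_operator ::
  "('m, 'e::euclidean_space) chart set \<Rightarrow>
   (('m \<Rightarrow> complex) \<Rightarrow> ('m \<Rightarrow> complex) \<Rightarrow> 'm \<Rightarrow> complex) \<Rightarrow> bool" where
  "bidifferential_operator A B \<longleftrightarrow>
     (\<exists>k. \<forall>c\<in>A. \<exists>a. (\<forall>bs\<in>multi_indices k. \<forall>ds\<in>multi_indices k. smooth_on (chart_image c) (a bs ds)) \<and>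
        (\<forall>f\<in>smooth_functions A. \<forall>g\<in>smooth_functions A. \<forall>p\<in>fst c.
           B f g p = (\<Sum>bs\<in>multi_indices k. \<Sum>ds\<in>multi_indices k.
             a bs ds (snd c p) * iter_partial bs (f \<circ> chart_inv c) (snd c p)
                               * iter_partial ds (g \<circ> chart_inv c) (snd c p))))"

section \<open>Star products and equivalence transformations\<close>

text \<open>\<open>formal_functions A\<close> is \<open>C\<^sup>\<infinity>(M)[[\<nu>]]\<close>; the formal parameter \<open>\<nu>\<close> is the variable of the
  formal power series.\<close>

definition formal_functions ::
  "('m, 'e::euclidean_space) chart set \<Rightarrow> ('m \<Rightarrow> complex) fps set" where
  "formal_functions A = {f. \<forall>n. fps_nth f n \<in> smooth_functions A}"

text \<open>The action of \<open>\<complex>[[\<nu>]]\<close>: the Cauchy product with a series of constant functions.\<close>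

definition formal_scale :: "complex fps \<Rightarrow> ('m \<Rightarrow> complex) fps \<Rightarrow> ('m \<Rightarrow> complex) fps" where
  "formal_scale \<alpha> f = Abs_fps (\<lambda>n p. fps_nth \<alpha> n) * f"

text \<open>In the formula for \<open>f \<star> g\<close> the maps \<open>C i\<close> are extended to formal series by
  bilinearity over \<open>\<complex>[[\<nu>]]\<close>.\<close>

definition star_product ::
  "('m, 'e::euclidean_space) chart set \<Rightarrow> 'm two_form \<Rightarrow>
   (('m \<Rightarrow> complex) fps \<Rightarrow> ('m \<Rightarrow> complex) fps \<Rightarrow> ('m \<Rightarrow> complex) fps) \<Rightarrow> bool" where
  "star_product A \<omega> star \<longleftrightarrow>
     (\<forall>f\<in>formal_functions A. \<forall>g\<in>formal_functions A. star f g \<in> formal_functions A) \<and>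
     (\<forall>f\<in>formal_functions A. \<forall>g\<in>formal_functions A. \<forall>h\<in>formal_functions A.
        star (f + g) h = star f h + star g h \<and> star h (f + g) = star h f + star h g) \<and>
     (\<forall>\<alpha>. \<forall>f\<in>formal_functions A. \<forall>g\<in>formal_functions A.
        star (formal_scale \<alpha> f) g = formal_scale \<alpha> (star f g) \<and>
        star f (formal_scale \<alpha> g) = formal_scale \<alpha> (star f g)) \<and>
     (\<forall>f\<in>formal_functions A. \<forall>g\<in>formal_functions A. \<forall>h\<in>formal_functions A.
        star (star f g) h = star f (star g h)) \<and>
     (\<exists>C. (\<forall>i. bidifferential_operator A (C i)) \<and>
        (\<forall>f\<in>formal_functions A. \<forall>g\<in>formal_functions A.
           star f g = Abs_fps (\<lambda>n. \<Sum>i\<le>n. \<Sum>j\<le>n - i. C i (fps_nth f j) (fps_nth g (n - i - j)))) \<and>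
        (\<forall>f\<in>smooth_functions A. \<forall>g\<in>smooth_functions A.
           C 0 f g = f * g \<and> C 1 f g - C 1 g f = poisson_bracket A \<omega> f g))"

definition equivalence_transformation ::
  "('m, 'e::euclidean_space) chart set \<Rightarrow>
   (('m \<Rightarrow> complex) fps \<Rightarrow> ('m \<Rightarrow> complex) fps \<Rightarrow> ('m \<Rightarrow> complex) fps) \<Rightarrow>
   (('m \<Rightarrow> complex) fps \<Rightarrow> ('m \<Rightarrow> complex) fps \<Rightarrow> ('m \<Rightarrow> complex) fps) \<Rightarrow>
   (('m \<Rightarrow> complex) fps \<Rightarrow> ('m \<Rightarrow> complex) fps) \<Rightarrow> bool" where
  "equivalence_transformation A star1 star2 S \<longleftrightarrow>
     (\<forall>f\<in>formal_functions A. S f \<in> formal_functions A) \<and>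
     (\<forall>f\<in>formal_functions A. \<forall>g\<in>formal_functions A. S (f + g) = S f + S g) \<and>
     (\<forall>\<alpha>. \<forall>f\<in>formal_functions A. S (formal_scale \<alpha> f) = formal_scale \<alpha> (S f)) \<and>
     (\<exists>D. (\<forall>i\<ge>1. differential_operator A (D i)) \<and>
        (\<forall>f\<in>formal_functions A.
           S f = Abs_fps (\<lambda>n. fps_nth f n + (\<Sum>i=1..n. D i (fps_nth f (n - i)))))) \<and>
     (\<forall>f\<in>formal_functions A. \<forall>g\<in>formal_functions A. S (star1 f g) = star2 (S f) (S g))"

definition equivalent_star_products ::
  "('m, 'e::euclidean_space) chart set \<Rightarrow>
   (('m \<Rightarrow> complex) fps \<Rightarrow> ('m \<Rightarrow> complex) fps \<Rightarrow> ('m \<Rightarrow> complex) fps) \<Rightarrow>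
   (('m \<Rightarrow> complex) fps \<Rightarrow> ('m \<Rightarrow> complex) fps \<Rightarrow> ('m \<Rightarrow> complex) fps) \<Rightarrow> bool" where
  "equivalent_star_products A star1 star2 \<longleftrightarrow> (\<exists>S. equivalence_transformation A star1 star2 S)"

section \<open>Complex conjugation, parity, Weyl type\<close>

definition formal_conj :: "('m \<Rightarrow> complex) fps \<Rightarrow> ('m \<Rightarrow> complex) fps" where
  "formal_conj f = Abs_fps (\<lambda>n p. (-1) ^ n * cnj (fps_nth f n p))"

definition formal_parity :: "('m \<Rightarrow> complex) fps \<Rightarrow> ('m \<Rightarrow> complex) fps" where
  "formal_parity f = Abs_fps (\<lambda>n p. (-1) ^ n * fps_nth f n p)"

definition conj_star_structure ::
  "('m, 'e::euclidean_space) chart set \<Rightarrow>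
   (('m \<Rightarrow> complex) fps \<Rightarrow> ('m \<Rightarrow> complex) fps \<Rightarrow> ('m \<Rightarrow> complex) fps) \<Rightarrow> bool" where
  "conj_star_structure A star \<longleftrightarrow>
     (\<forall>f\<in>formal_functions A. \<forall>g\<in>formal_functions A.
        formal_conj (star (formal_conj f) (formal_conj g)) = star g f)"

definition parity_property ::
  "('m, 'e::euclidean_space) chart set \<Rightarrow>
   (('m \<Rightarrow> complex) fps \<Rightarrow> ('m \<Rightarrow> complex) fps \<Rightarrow> ('m \<Rightarrow> complex) fps) \<Rightarrow> bool" where
  "parity_property A star \<longleftrightarrow>
     (\<forall>f\<in>formal_functions A. \<forall>g\<in>formal_functions A.
        formal_parity (star (formal_parity f) (formal_parity g)) = star g f)"

definition weyl_type ::
  "('m, 'e::euclidean_space) chart set \<Rightarrow>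
   (('m \<Rightarrow> complex) fps \<Rightarrow> ('m \<Rightarrow> complex) fps \<Rightarrow> ('m \<Rightarrow> complex) fps) \<Rightarrow> bool" where
  "weyl_type A star \<longleftrightarrow> conj_star_structure A star \<and> parity_property A star"

text \<open>\<open>C S C = S\<close> and \<open>P S P = S\<close> as maps on \<open>C\<^sup>\<infinity>(M)[[\<nu>]]\<close>.\<close>

definition conj_invariant ::
  "('m, 'e::euclidean_space) chart set \<Rightarrow> (('m \<Rightarrow> complex) fps \<Rightarrow> ('m \<Rightarrow> complex) fps) \<Rightarrow> bool" where
  "conj_invariant A S \<longleftrightarrow> (\<forall>f\<in>formal_functions A. formal_conj (S (formal_conj f)) = S f)"

definition parity_invariant ::
  "('m, 'e::euclidean_space) chart set \<Rightarrow> (('m \<Rightarrow> complex) fps \<Rightarrow> ('m \<Rightarrow> complex) fps) \<Rightarrow> bool" where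
  "parity_invariant A S \<longleftrightarrow> (\<forall>f\<in>formal_functions A. formal_parity (S (formal_parity f)) = S f)"

end

theory Submission
  imports Defs
begin

text \<open>
  Let \<open>J\<close> be \<open>C\<close> or \<open>P\<close>, \<open>S\<close> an equivalence and \<open>T = J S J\<close>, which is again an equivalence.
  Solving order by order gives a unique formal series of differential operators \<open>B = id + O(\<nu>)\<close> with
  \<open>S B B = T\<close>; the claim is that \<open>U = S B\<close> is a \<open>J\<close>-invariant equivalence.  Everything rests on one
  observation: if \<open>P \<Delta> Y + Q \<Delta> = 0\<close> with \<open>P\<close>, \<open>Q\<close>, \<open>Y\<close> equal to the identity modulo \<open>\<nu>\<close>, then the
  leading coefficient of \<open>\<Delta>\<close> is annihilated by \<open>2\<close>, so \<open>\<Delta> = 0\<close>.  Applied to the defect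
  \<open>B(f \<star>\<^sub>1 g) - Bf \<star>\<^sub>1 Bg\<close> it shows that \<open>B\<close> is an automorphism of \<open>\<star>\<^sub>1\<close>, since \<open>B B = S\<^sup>-\<^sup>1 T\<close> is one.
  With \<open>B' = J B J\<close> the equations \<open>S B B = T\<close> and \<open>T B' B' = S\<close> give \<open>B B B' B' = id\<close>, hence
  \<open>B B' = id\<close> and \<open>J U J = T B' = S B = U\<close>.  For the Weyl case one starts from a \<open>C\<close>-invariant \<open>S\<close> and
  takes \<open>J = P\<close>; then \<open>C B C\<close> is another square root of \<open>S\<^sup>-\<^sup>1 T\<close>, so it equals \<open>B\<close>, and \<open>U\<close> remains
  \<open>C\<close>-invariant.
\<close>

section \<open>Iterated partial derivatives and smooth functions\<close>

text \<open>\<open>frechet_derivative\<close> is a choice operator, so no differentiability is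
  required: the two functions have the same candidate derivatives at x, and the choice made from
  them is the same.\<close>

lemma frechet_derivative_cong:
  assumes "open X" "x \<in> X" "\<And>y. y \<in> X \<Longrightarrow> F y = G y"
  shows "frechet_derivative F (at x) = frechet_derivative G (at x)"
proof -
  have "(F has_derivative D) (at x) \<longleftrightarrow> (G has_derivative D) (at x)" for D
    using has_derivative_transform_within_open[OF _ assms(1,2)] assms(3) by metis
  then show ?thesis
    by (simp add: frechet_derivative_def)
qed

lemma differentiable_cong_open:
  assumes "open X" "x \<in> X" "\<And>y. y \<in> X \<Longrightarrow> F y = G y" "G differentiable (at x)"
  shows "F differentiable (at x)"
  using has_derivative_transform_within_open[OF _ assms(1,2)] assms(3,4)
  unfolding differentiable_def by metis

lemma iter_partial_cong:
  assumes "open X" "\<And>y. y \<in> X \<Longrightarrow> F y = G y" "x \<in> X"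
  shows "iter_partial bs F x = iter_partial bs G x"
  using assms(3)
proof (induction bs arbitrary: x)
  case (Cons b bs)
  then show ?case
    using frechet_derivative_cong[OF assms(1), of x "iter_partial bs F" "iter_partial bs G"] by simp
qed (simp add: assms)

lemma iter_partial_append: "iter_partial (bs @ ds) F = iter_partial bs (iter_partial ds F)"
  by (induction bs) auto

lemma smooth_onD:
  assumes "smooth_on X F" "set bs \<subseteq> Basis" "x \<in> X"
  shows "iter_partial bs F differentiable (at x)"
  using assms by (simp add: smooth_on_def)

lemma smooth_on_imp_open: "smooth_on X F \<Longrightarrow> open X"
  by (simp add: smooth_on_def)

lemma smooth_on_differentiable: "smooth_on X F \<Longrightarrow> x \<in> X \<Longrightarrow> F differentiable (at x)"
  using smooth_onD[of X F "[]"] by simp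

lemma smooth_on_iter_partial:
  "smooth_on X F \<Longrightarrow> set bs \<subseteq> Basis \<Longrightarrow> smooth_on X (iter_partial bs F)"
  unfolding smooth_on_def by (metis Un_least iter_partial_append set_append)

lemma smooth_on_cong:
  assumes "\<And>y. y \<in> X \<Longrightarrow> F y = G y" "smooth_on X G"
  shows "smooth_on X F"
  unfolding smooth_on_def
proof (intro conjI allI impI ballI)
  show op: "open X" using assms(2) by (rule smooth_on_imp_open)
  fix bs x assume "set bs \<subseteq> (Basis :: 'a set)" "x \<in> X"
  then show "iter_partial bs F differentiable (at x)"
    using differentiable_cong_open[OF op, of x "iter_partial bs F"] iter_partial_cong[OF op] assms smooth_onD
    by metis
qed

text \<open>By induction on the list, every iterated partial derivative of F coincides on X with
  some member of \<F>. Agreement on X suffices because X is open and derivatives are local.\<close>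

lemma smooth_on_coinduct:
  assumes "open X" "F \<in> \<F>"
    and diff: "\<And>F x. F \<in> \<F> \<Longrightarrow> x \<in> X \<Longrightarrow> F differentiable (at x)"
    and step: "\<And>F b. F \<in> \<F> \<Longrightarrow> b \<in> Basis \<Longrightarrow>
      \<exists>G\<in>\<F>. \<forall>x\<in>X. frechet_derivative F (at x) b = G x"
  shows "smooth_on X F"
proof -
  have partials: "\<exists>G\<in>\<F>. \<forall>x\<in>X. iter_partial bs F x = G x" if "set bs \<subseteq> Basis" for bs
    using that
  proof (induction bs)
    case (Cons b bs)
    then obtain G where G: "G \<in> \<F>" "\<forall>x\<in>X. iter_partial bs F x = G x" by auto
    have "iter_partial (b # bs) F x = frechet_derivative G (at x) b" if "x \<in> X" for x
      using frechet_derivative_cong[OF assms(1) that, of "iter_partial bs F" G] G(2) by simp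
    with step[OF G(1), of b] Cons.prems show ?case by auto
  qed (use assms(2) in auto)
  show ?thesis
    unfolding smooth_on_def
  proof (intro conjI allI impI ballI assms(1))
    fix bs x assume "set bs \<subseteq> (Basis :: 'a set)" "x \<in> X"
    then show "iter_partial bs F differentiable (at x)"
      using partials[of bs] diff differentiable_cong_open[OF assms(1), of x "iter_partial bs F"] by metis
  qed
qed

text \<open>This class is closed under partial derivatives by the Leibniz rule, so coinduction yields
  smoothness of sums and products without a higher-order Leibniz formula.\<close>

inductive_set smooth_algebra :: "'e::euclidean_space set \<Rightarrow> ('e \<Rightarrow> 'b::real_normed_algebra) set" for X where
  base: "smooth_on X F \<Longrightarrow> F \<in> smooth_algebra X"
| const: "(\<lambda>_. z) \<in> smooth_algebra X"
| add: "F \<in> smooth_algebra X \<Longrightarrow> G \<in> smooth_algebra X \<Longrightarrow> (\<lambda>x. F x + G x) \<in> smooth_algebra X"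
| mult: "F \<in> smooth_algebra X \<Longrightarrow> G \<in> smooth_algebra X \<Longrightarrow> (\<lambda>x. F x * G x) \<in> smooth_algebra X"

section \<open>Sums, products and linear images of smooth functions\<close>

lemma frechet_derivative_add_at:
  assumes "F differentiable (at x)" "G differentiable (at x)"
  shows "frechet_derivative (\<lambda>x. F x + G x) (at x) b
    = frechet_derivative F (at x) b + frechet_derivative G (at x) b"
  using frechet_derivative_at[OF has_derivative_add[OF assms[unfolded frechet_derivative_works]]]
  by metis

lemma frechet_derivative_mult_at:
  fixes F G :: "'a::real_normed_vector \<Rightarrow> 'b::real_normed_algebra"
  assumes "F differentiable (at x)" "G differentiable (at x)"
  shows "frechet_derivative (\<lambda>x. F x * G x) (at x) b
    = F x * frechet_derivative G (at x) b + frechet_derivative F (at x) b * G x"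
  using frechet_derivative_at[OF has_derivative_mult[OF assms[unfolded frechet_derivative_works]]]
  by metis

lemma smooth_algebra_differentiable:
  "F \<in> smooth_algebra X \<Longrightarrow> x \<in> X \<Longrightarrow> F differentiable (at x)"
  by (induction rule: smooth_algebra.induct) (auto intro: smooth_on_differentiable)

lemma smooth_algebra_partial:
  assumes "F \<in> smooth_algebra X" "b \<in> Basis"
  shows "\<exists>G\<in>smooth_algebra X. \<forall>x\<in>X. frechet_derivative F (at x) b = G x"
  using assms(1)
proof induction
  case (base F)
  then have "smooth_on X (iter_partial [b] F)"
    using assms(2) by (intro smooth_on_iter_partial) auto
  then show ?case by (intro bexI[of _ "iter_partial [b] F"]) (auto intro: smooth_algebra.base)
next
  case (const z)
  then show ?case by (intro bexI[of _ "\<lambda>_. 0"]) (auto intro: smooth_algebra.const)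
next
  case (add F G)
  then obtain F' G' where
    "F' \<in> smooth_algebra X" "\<forall>x\<in>X. frechet_derivative F (at x) b = F' x"
    "G' \<in> smooth_algebra X" "\<forall>x\<in>X. frechet_derivative G (at x) b = G' x" by auto
  then show ?case using add
    by (intro bexI[of _ "\<lambda>x. F' x + G' x"])
      (auto intro: smooth_algebra.add simp: frechet_derivative_add_at smooth_algebra_differentiable)
next
  case (mult F G)
  then obtain F' G' where
    "F' \<in> smooth_algebra X" "\<forall>x\<in>X. frechet_derivative F (at x) b = F' x"
    "G' \<in> smooth_algebra X" "\<forall>x\<in>X. frechet_derivative G (at x) b = G' x" by auto
  then show ?case using mult
    by (intro bexI[of _ "\<lambda>x. F x * G' x + F' x * G x"])
      (auto intro!: smooth_algebra.add smooth_algebra.mult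
        simp: frechet_derivative_mult_at smooth_algebra_differentiable)
qed

lemma smooth_algebra_smooth_on: "open X \<Longrightarrow> F \<in> smooth_algebra X \<Longrightarrow> smooth_on X F"
  using smooth_on_coinduct[of X F "smooth_algebra X"] smooth_algebra_differentiable smooth_algebra_partial
  by metis

lemma smooth_on_const: "open X \<Longrightarrow> smooth_on X (\<lambda>_. z :: 'b::real_normed_algebra)"
  by (simp add: smooth_algebra_smooth_on smooth_algebra.const)

lemma smooth_on_add:
  fixes F G :: "'e::euclidean_space \<Rightarrow> 'b::real_normed_algebra"
  shows "smooth_on X F \<Longrightarrow> smooth_on X G \<Longrightarrow> smooth_on X (\<lambda>x. F x + G x)"
  by (auto intro!: smooth_algebra_smooth_on smooth_algebra.add intro: smooth_algebra.base dest: smooth_on_imp_open)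

lemma smooth_on_mult:
  fixes F G :: "'e::euclidean_space \<Rightarrow> 'b::real_normed_algebra"
  shows "smooth_on X F \<Longrightarrow> smooth_on X G \<Longrightarrow> smooth_on X (\<lambda>x. F x * G x)"
  by (auto intro!: smooth_algebra_smooth_on smooth_algebra.mult intro: smooth_algebra.base dest: smooth_on_imp_open)

lemma smooth_on_sum:
  fixes F :: "'i \<Rightarrow> 'e::euclidean_space \<Rightarrow> 'b::real_normed_algebra"
  assumes "open X" "\<And>i. i \<in> I \<Longrightarrow> smooth_on X (F i)"
  shows "smooth_on X (\<lambda>x. \<Sum>i\<in>I. F i x)"
  using assms(2)
  by (induction I rule: infinite_finite_induct) (auto intro: smooth_on_const smooth_on_add assms(1))

lemma iter_partial_add:
  fixes F G :: "'e::euclidean_space \<Rightarrow> 'b::real_normed_vector"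
  assumes "smooth_on X F" "smooth_on X G" "set bs \<subseteq> Basis" "x \<in> X"
  shows "iter_partial bs (\<lambda>x. F x + G x) x = iter_partial bs F x + iter_partial bs G x"
  using assms(3,4)
proof (induction bs arbitrary: x)
  case (Cons b bs)
  have "iter_partial (b # bs) (\<lambda>x. F x + G x) x
      = frechet_derivative (\<lambda>x. iter_partial bs F x + iter_partial bs G x) (at x) b"
    using frechet_derivative_cong[OF smooth_on_imp_open[OF assms(1)] \<open>x \<in> X\<close>,
        of "iter_partial bs (\<lambda>x. F x + G x)" "\<lambda>x. iter_partial bs F x + iter_partial bs G x"] Cons
    by simp
  then show ?case
    using Cons.prems assms by (simp add: frechet_derivative_add_at smooth_onD)
qed simp

text \<open>Linearity is over the reals, which covers complex conjugation as well as multiplication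
  by a constant.\<close>

lemma iter_partial_bounded_linear:
  fixes F :: "'e::euclidean_space \<Rightarrow> 'b::real_normed_vector"
  assumes "bounded_linear c" "smooth_on X F" "set bs \<subseteq> Basis" "x \<in> X"
  shows "iter_partial bs (\<lambda>x. c (F x)) x = c (iter_partial bs F x)"
  using assms(3,4)
proof (induction bs arbitrary: x)
  case (Cons b bs)
  have "iter_partial (b # bs) (\<lambda>x. c (F x)) x
      = frechet_derivative (\<lambda>x. c (iter_partial bs F x)) (at x) b"
    using frechet_derivative_cong[OF smooth_on_imp_open[OF assms(2)] \<open>x \<in> X\<close>,
        of "iter_partial bs (\<lambda>x. c (F x))" "\<lambda>x. c (iter_partial bs F x)"] Cons
    by simp
  moreover have "iter_partial bs F differentiable (at x)"
    using Cons.prems assms by (simp add: smooth_onD)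
  then have "((\<lambda>x. c (iter_partial bs F x)) has_derivative
      (\<lambda>b. c (frechet_derivative (iter_partial bs F) (at x) b))) (at x)"
    by (intro bounded_linear.has_derivative[OF assms(1)]) (simp add: frechet_derivative_works[symmetric])
  ultimately show ?case
    by (simp add: frechet_derivative_at[symmetric])
qed simp

lemma smooth_on_bounded_linear:
  fixes F :: "'e::euclidean_space \<Rightarrow> 'b::real_normed_vector"
  assumes "bounded_linear c" "smooth_on X F"
  shows "smooth_on X (\<lambda>x. c (F x))"
  unfolding smooth_on_def
proof (intro conjI allI impI ballI)
  show op: "open X" using assms(2) by (rule smooth_on_imp_open)
  fix bs x assume "set bs \<subseteq> (Basis :: 'e set)" "x \<in> X"
  moreover have "(\<lambda>x. c (iter_partial bs F x)) differentiable (at x)"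
    using smooth_onD[OF assms(2) calculation] bounded_linear.has_derivative[OF assms(1)]
    unfolding differentiable_def by metis
  ultimately show "iter_partial bs (\<lambda>x. c (F x)) differentiable (at x)"
    using differentiable_cong_open[OF op, of x "iter_partial bs (\<lambda>x. c (F x))"]
      iter_partial_bounded_linear[OF assms] by simp
qed

lemma iter_partial_cmult:
  fixes F :: "'e::euclidean_space \<Rightarrow> 'b::real_normed_algebra"
  assumes "smooth_on X F" "set bs \<subseteq> Basis" "x \<in> X"
  shows "iter_partial bs (\<lambda>x. z * F x) x = z * iter_partial bs F x"
  using iter_partial_bounded_linear[OF bounded_linear_mult_right assms] .

section \<open>Differential operators\<close>

text \<open>Quantifies over all functions smooth on X, not only over coordinate expressions of
  globally smooth functions, so that operators can be composed within one chart.\<close>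

definition local_operator :: "'e::euclidean_space set \<Rightarrow> nat \<Rightarrow>
    (('e \<Rightarrow> 'b::real_normed_algebra) \<Rightarrow> 'e \<Rightarrow> 'b) \<Rightarrow> bool" where
  "local_operator X k L \<longleftrightarrow>
     (\<exists>a. (\<forall>bs\<in>multi_indices k. smooth_on X (a bs)) \<and>
        (\<forall>F. smooth_on X F \<longrightarrow>
          (\<forall>x\<in>X. L F x = (\<Sum>bs\<in>multi_indices k. a bs x * iter_partial bs F x))))"

lemma local_operatorE:
  assumes "local_operator X k L"
  obtains a where "\<And>bs. bs \<in> multi_indices k \<Longrightarrow> smooth_on X (a bs)"
    "\<And>F x. smooth_on X F \<Longrightarrow> x \<in> X \<Longrightarrow> L F x = (\<Sum>bs\<in>multi_indices k. a bs x * iter_partial bs F x)"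
  using assms unfolding local_operator_def by metis

lemma finite_multi_indices: "finite (multi_indices k)"
  unfolding multi_indices_def by (rule finite_lists_length_le) simp

lemma multi_indices_set: "bs \<in> multi_indices k \<Longrightarrow> set bs \<subseteq> Basis"
  by (simp add: multi_indices_def)

lemma local_operator_cong:
  assumes "local_operator X k L" "\<And>F x. smooth_on X F \<Longrightarrow> x \<in> X \<Longrightarrow> L' F x = L F x"
  shows "local_operator X k L'"
  using assms unfolding local_operator_def by auto

lemma local_operator_smooth_on:
  assumes "open X" "local_operator X k L" "smooth_on X F"
  shows "smooth_on X (L F)"
proof -
  obtain a where a: "\<And>bs. bs \<in> multi_indices k \<Longrightarrow> smooth_on X (a bs)"
    "\<And>x. x \<in> X \<Longrightarrow> L F x = (\<Sum>bs\<in>multi_indices k. a bs x * iter_partial bs F x)"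
    using local_operatorE[OF assms(2)] assms(3) by metis
  show ?thesis
    by (rule smooth_on_cong[OF a(2)])
      (auto intro!: smooth_on_sum smooth_on_mult a(1) smooth_on_iter_partial assms
        dest: multi_indices_set)
qed

lemma local_operator_monomial:
  assumes "open X" "smooth_on X a" "ds \<in> multi_indices k"
  shows "local_operator X k (\<lambda>F x. a x * iter_partial ds F x)"
  unfolding local_operator_def
proof (intro exI conjI allI impI ballI)
  let ?a = "\<lambda>bs. if bs = ds then a else (\<lambda>_. 0)"
  show "smooth_on X (?a bs)" for bs
    using assms smooth_on_const by auto
  fix F :: "'a \<Rightarrow> 'b" and x
  have "(\<Sum>bs\<in>multi_indices k. ?a bs x * iter_partial bs F x)
      = (\<Sum>bs\<in>multi_indices k. if bs = ds then a x * iter_partial ds F x else 0)"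
    by (intro sum.cong) auto
  then show "a x * iter_partial ds F x = (\<Sum>bs\<in>multi_indices k. ?a bs x * iter_partial bs F x)"
    using assms(3) finite_multi_indices[of k, where 'a = 'a]
    by (simp only: sum.delta if_True)
qed

lemma local_operator_zero: "open X \<Longrightarrow> local_operator X k (\<lambda>F x. 0)"
  unfolding local_operator_def
  by (rule exI[of _ "\<lambda>_ _. 0"]) (auto intro: smooth_on_const)

lemma local_operator_add:
  assumes "local_operator X k L" "local_operator X k M"
  shows "local_operator X k (\<lambda>F x. L F x + M F x)"
proof -
  obtain a where "\<And>bs. bs \<in> multi_indices k \<Longrightarrow> smooth_on X (a bs)"
    "\<And>F x. smooth_on X F \<Longrightarrow> x \<in> X \<Longrightarrow> L F x = (\<Sum>bs\<in>multi_indices k. a bs x * iter_partial bs F x)"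
    using local_operatorE[OF assms(1)] by metis
  moreover obtain b where "\<And>bs. bs \<in> multi_indices k \<Longrightarrow> smooth_on X (b bs)"
    "\<And>F x. smooth_on X F \<Longrightarrow> x \<in> X \<Longrightarrow> M F x = (\<Sum>bs\<in>multi_indices k. b bs x * iter_partial bs F x)"
    using local_operatorE[OF assms(2)] by metis
  ultimately show ?thesis
    unfolding local_operator_def
    by (intro exI[of _ "\<lambda>bs x. a bs x + b bs x"])
      (auto intro: smooth_on_add simp: sum.distrib distrib_right)
qed

lemma local_operator_sum:
  assumes "open X" "\<And>i. i \<in> I \<Longrightarrow> local_operator X k (L i)"
  shows "local_operator X k (\<lambda>F x. \<Sum>i\<in>I. L i F x)"
  using assms(2)
  by (induction I rule: infinite_finite_induct)
    (auto intro: local_operator_zero local_operator_add assms(1))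

lemma local_operator_mult:
  fixes L :: "('e::euclidean_space \<Rightarrow> 'b::real_normed_algebra) \<Rightarrow> 'e \<Rightarrow> 'b"
  assumes "smooth_on X m" "local_operator X k L"
  shows "local_operator X k (\<lambda>F x. m x * L F x)"
proof -
  obtain a where "\<And>bs. bs \<in> multi_indices k \<Longrightarrow> smooth_on X (a bs)"
    "\<And>F x. smooth_on X F \<Longrightarrow> x \<in> X \<Longrightarrow> L F x = (\<Sum>bs\<in>multi_indices k. a bs x * iter_partial bs F x)"
    using local_operatorE[OF assms(2)] by metis
  then show ?thesis
    unfolding local_operator_def
    by (intro exI[of _ "\<lambda>bs x. m x * a bs x"])
      (auto intro: smooth_on_mult assms simp: sum_distrib_left mult.assoc)
qed

text \<open>The given coefficients are arbitrary on lists longer than k and cannot simply be reused.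
  Writing the operator as a sum of monomials of order at most k fills the new places with
  zeros.\<close>

lemma local_operator_mono:
  assumes "open X" "k \<le> k'" "local_operator X k L"
  shows "local_operator X k' L"
proof -
  obtain a where a: "\<And>bs. bs \<in> multi_indices k \<Longrightarrow> smooth_on X (a bs)"
    "\<And>F x. smooth_on X F \<Longrightarrow> x \<in> X \<Longrightarrow> L F x = (\<Sum>bs\<in>multi_indices k. a bs x * iter_partial bs F x)"
    using local_operatorE[OF assms(3)] by metis
  have "bs \<in> multi_indices k'" if "bs \<in> multi_indices k" for bs :: "'a list"
    using that assms(2) by (auto simp: multi_indices_def)
  then have "local_operator X k' (\<lambda>F x. \<Sum>bs\<in>multi_indices k. a bs x * iter_partial bs F x)"
    using a(1) by (intro local_operator_sum local_operator_monomial assms(1))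
  then show ?thesis
    by (rule local_operator_cong) (rule a(2))
qed

lemma frechet_derivative_sum_at:
  assumes "\<And>i. i \<in> I \<Longrightarrow> F i differentiable (at x)"
  shows "frechet_derivative (\<lambda>x. \<Sum>i\<in>I. F i x) (at x) b = (\<Sum>i\<in>I. frechet_derivative (F i) (at x) b)"
proof -
  have "((\<lambda>x. \<Sum>i\<in>I. F i x) has_derivative (\<lambda>b. \<Sum>i\<in>I. frechet_derivative (F i) (at x) b)) (at x)"
    using assms by (intro has_derivative_sum) (simp add: frechet_derivative_works[symmetric])
  then show ?thesis
    by (simp add: frechet_derivative_at[symmetric])
qed

lemma local_operator_partial:
  fixes L :: "('e::euclidean_space \<Rightarrow> 'b::real_normed_algebra) \<Rightarrow> 'e \<Rightarrow> 'b"
  assumes "open X" "local_operator X k L" "b \<in> Basis"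
  shows "local_operator X (Suc k) (\<lambda>F. iter_partial [b] (L F))"
proof -
  obtain a where a: "\<And>bs. bs \<in> multi_indices k \<Longrightarrow> smooth_on X (a bs)"
    and L: "\<And>F x. smooth_on X F \<Longrightarrow> x \<in> X \<Longrightarrow> L F x = (\<Sum>bs\<in>multi_indices k. a bs x * iter_partial bs F x)"
    using local_operatorE[OF assms(2)] by metis
  \<comment> \<open>The Leibniz rule applied to each term: b falls either on the derivative of F,
    which raises the order by one, or on the coefficient.\<close>
  let ?M = "\<lambda>F x. \<Sum>bs\<in>multi_indices k.
    a bs x * iter_partial (b # bs) F x + iter_partial [b] (a bs) x * iter_partial bs F x"
  have "local_operator X (Suc k) ?M"
    using assms(3) a
    by (intro local_operator_sum local_operator_add local_operator_monomial assms(1) smooth_on_iter_partial)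
      (auto simp: multi_indices_def)
  then show ?thesis
  proof (rule local_operator_cong)
    fix F :: "'e \<Rightarrow> 'b" and x assume F: "smooth_on X F" "x \<in> X"
    have diff: "a bs differentiable (at x)" "iter_partial bs F differentiable (at x)"
      if "bs \<in> multi_indices k" for bs
      using that F a by (auto intro: smooth_on_differentiable smooth_onD dest: multi_indices_set)
    have "iter_partial [b] (L F) x = iter_partial [b] (\<lambda>x. \<Sum>bs\<in>multi_indices k. a bs x * iter_partial bs F x) x"
      using L F by (intro iter_partial_cong[OF assms(1)]) auto
    also have "\<dots> = ?M F x"
      using diff by (simp add: frechet_derivative_sum_at frechet_derivative_mult_at)
    finally show "iter_partial [b] (L F) x = ?M F x" .
  qed
qed

lemma local_operator_iter_partial:
  assumes "open X" "local_operator X k L" "set bs \<subseteq> Basis"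
  shows "local_operator X (length bs + k) (\<lambda>F. iter_partial bs (L F))"
  using assms(3)
proof (induction bs)
  case (Cons b bs)
  then show ?case
    using local_operator_partial[OF assms(1), of "length bs + k" "\<lambda>F. iter_partial bs (L F)" b] by simp
qed (simp add: assms)

text \<open>Each term of L differentiates \<open>M F\<close> along a list of length at most k, which
  raises the order l of M by at most k; multiplying by the coefficients of L leaves the order
  alone.\<close>

lemma local_operator_comp:
  fixes L M :: "('e::euclidean_space \<Rightarrow> 'b::real_normed_algebra) \<Rightarrow> 'e \<Rightarrow> 'b"
  assumes "open X" "local_operator X k L" "local_operator X l M"
  shows "local_operator X (k + l) (\<lambda>F. L (M F))"
proof -
  obtain a where a: "\<And>bs. bs \<in> multi_indices k \<Longrightarrow> smooth_on X (a bs)"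
    and L: "\<And>F x. smooth_on X F \<Longrightarrow> x \<in> X \<Longrightarrow> L F x = (\<Sum>bs\<in>multi_indices k. a bs x * iter_partial bs F x)"
    using local_operatorE[OF assms(2)] by metis
  have "local_operator X (k + l) (\<lambda>F. iter_partial bs (M F))" if "bs \<in> multi_indices k" for bs
    using that
    by (intro local_operator_mono[OF assms(1) _ local_operator_iter_partial[OF assms(1,3), of bs]])
      (auto simp: multi_indices_def)
  then have "local_operator X (k + l) (\<lambda>F x. \<Sum>bs\<in>multi_indices k. a bs x * iter_partial bs (M F) x)"
    using a by (intro local_operator_sum local_operator_mult assms(1)) auto
  then show ?thesis
    by (rule local_operator_cong) (intro L local_operator_smooth_on[OF assms(1,3)])
qed

text \<open>As the order has to be uniform over the atlas, the order is made explicit here.\<close>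

definition operator_of_order ::
  "('m, 'e::euclidean_space) chart set \<Rightarrow> nat \<Rightarrow> (('m \<Rightarrow> complex) \<Rightarrow> 'm \<Rightarrow> complex) \<Rightarrow> bool" where
  "operator_of_order A k D \<longleftrightarrow>
     (\<forall>c\<in>A. \<exists>L. local_operator (chart_image c) k L \<and>
        (\<forall>f\<in>smooth_functions A. \<forall>p\<in>fst c. D f p = L (f \<circ> chart_inv c) (snd c p)))"

section \<open>Differential operators on a manifold and their closure properties\<close>

locale smooth_manifold =
  fixes A :: "('m::{t2_space,second_countable_topology}, 'e::euclidean_space) chart set"
  assumes atlas: "smooth_atlas A"
begin

lemma open_chart_image: "c \<in> A \<Longrightarrow> open (chart_image c)"
  using atlas by (simp add: smooth_atlas_def)

lemma chart_inv_apply: "c \<in> A \<Longrightarrow> p \<in> fst c \<Longrightarrow> chart_inv c (snd c p) = p"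
  using atlas by (simp add: smooth_atlas_def homeomorphism_def)

lemma chart_apply_inv: "x \<in> chart_image c \<Longrightarrow> snd c (chart_inv c x) = x"
  by (simp add: chart_image_def chart_inv_def f_inv_into_f)

lemma chart_inv_mem: "x \<in> chart_image c \<Longrightarrow> chart_inv c x \<in> fst c"
  by (simp add: chart_image_def chart_inv_def inv_into_into)

lemma chart_mem_image: "p \<in> fst c \<Longrightarrow> snd c p \<in> chart_image c"
  by (simp add: chart_image_def)

lemma in_chart: obtains c where "c \<in> A" "p \<in> fst c"
proof -
  have "p \<in> (\<Union>c\<in>A. fst c)"
    using atlas by (simp add: smooth_atlas_def)
  then show ?thesis using that by blast
qed

lemma smooth_functionsD: "f \<in> smooth_functions A \<Longrightarrow> c \<in> A \<Longrightarrow> smooth_on (chart_image c) (f \<circ> chart_inv c)"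
  by (simp add: smooth_functions_def)

text \<open>Hides the coefficients behind a local operator in each chart, so that the closure
  properties below reduce to those of \<open>local_operator\<close>.\<close>

lemma differential_operator_iff: "differential_operator A D \<longleftrightarrow> (\<exists>k. operator_of_order A k D)"
proof
  assume "differential_operator A D"
  then obtain k where k: "\<forall>c\<in>A. \<exists>a. (\<forall>bs\<in>multi_indices k. smooth_on (chart_image c) (a bs)) \<and>
        (\<forall>f\<in>smooth_functions A. \<forall>p\<in>fst c.
           D f p = (\<Sum>bs\<in>multi_indices k. a bs (snd c p) * iter_partial bs (f \<circ> chart_inv c) (snd c p)))"
    unfolding differential_operator_def by (elim exE)
  have "operator_of_order A k D"
    unfolding operator_of_order_def
  proof
    fix c assume "c \<in> A"
    with bspec[OF k] obtain a where "\<forall>bs\<in>multi_indices k. smooth_on (chart_image c) (a bs)"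
      "\<forall>f\<in>smooth_functions A. \<forall>p\<in>fst c.
         D f p = (\<Sum>bs\<in>multi_indices k. a bs (snd c p) * iter_partial bs (f \<circ> chart_inv c) (snd c p))"
      by blast
    then show "\<exists>L. local_operator (chart_image c) k L \<and>
        (\<forall>f\<in>smooth_functions A. \<forall>p\<in>fst c. D f p = L (f \<circ> chart_inv c) (snd c p))"
      by (intro exI[of _ "\<lambda>F x. \<Sum>bs\<in>multi_indices k. a bs x * iter_partial bs F x"])
        (auto simp: local_operator_def)
  qed
  then show "\<exists>k. operator_of_order A k D" ..
next
  assume "\<exists>k. operator_of_order A k D"
  then obtain k where k: "operator_of_order A k D" ..
  show "differential_operator A D"
    unfolding differential_operator_def
  proof (intro exI[of _ k] ballI)
    fix c assume c: "c \<in> A"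
    with k obtain L where L: "local_operator (chart_image c) k L"
      "\<forall>f\<in>smooth_functions A. \<forall>p\<in>fst c. D f p = L (f \<circ> chart_inv c) (snd c p)"
      unfolding operator_of_order_def by metis
    obtain a where a: "\<And>bs. bs \<in> multi_indices k \<Longrightarrow> smooth_on (chart_image c) (a bs)"
      "\<And>F x. smooth_on (chart_image c) F \<Longrightarrow> x \<in> chart_image c \<Longrightarrow>
        L F x = (\<Sum>bs\<in>multi_indices k. a bs x * iter_partial bs F x)"
      using local_operatorE[OF L(1)] by metis
    show "\<exists>a. (\<forall>bs\<in>multi_indices k. smooth_on (chart_image c) (a bs)) \<and>
        (\<forall>f\<in>smooth_functions A. \<forall>p\<in>fst c.
           D f p = (\<Sum>bs\<in>multi_indices k. a bs (snd c p) * iter_partial bs (f \<circ> chart_inv c) (snd c p)))"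
    proof (intro exI[of _ a] conjI ballI a(1))
      fix f :: "'m \<Rightarrow> complex" and p assume f: "f \<in> smooth_functions A" and p: "p \<in> fst c"
      show "D f p = (\<Sum>bs\<in>multi_indices k. a bs (snd c p) * iter_partial bs (f \<circ> chart_inv c) (snd c p))"
        using bspec[OF bspec[OF L(2) f] p] a(2)[OF smooth_functionsD[OF f c] chart_mem_image[OF p]]
        by (rule trans)
    qed
  qed
qed

lemma operator_of_orderE:
  assumes "operator_of_order A k D" "c \<in> A"
  obtains L where "local_operator (chart_image c) k L"
    "\<And>f p. f \<in> smooth_functions A \<Longrightarrow> p \<in> fst c \<Longrightarrow> D f p = L (f \<circ> chart_inv c) (snd c p)"
  using assms unfolding operator_of_order_def by metis

lemma differential_operator_smooth:
  assumes "differential_operator A D" "f \<in> smooth_functions A"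
  shows "D f \<in> smooth_functions A"
  unfolding smooth_functions_def
proof (intro CollectI ballI)
  fix c assume c: "c \<in> A"
  obtain k where "operator_of_order A k D"
    using assms differential_operator_iff by blast
  then obtain L where L: "local_operator (chart_image c) k L"
    "\<And>f p. f \<in> smooth_functions A \<Longrightarrow> p \<in> fst c \<Longrightarrow> D f p = L (f \<circ> chart_inv c) (snd c p)"
    using operator_of_orderE c by metis
  have "smooth_on (chart_image c) (L (f \<circ> chart_inv c))"
    by (intro local_operator_smooth_on[OF open_chart_image[OF c] L(1)] smooth_functionsD assms(2) c)
  then show "smooth_on (chart_image c) (D f \<circ> chart_inv c)"
    by (rule smooth_on_cong[rotated]) (simp add: L(2) assms(2) chart_inv_mem chart_apply_inv)
qed

lemma smooth_functions_const: "(\<lambda>_. z :: complex) \<in> smooth_functions A"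
  by (auto simp: smooth_functions_def comp_def intro: smooth_on_const open_chart_image)

lemma smooth_functions_zero: "(0 :: 'm \<Rightarrow> complex) \<in> smooth_functions A"
  using smooth_functions_const[of 0] by (simp add: zero_fun_def)

lemma smooth_functions_add:
  fixes f g :: "'m \<Rightarrow> complex"
  shows "f \<in> smooth_functions A \<Longrightarrow> g \<in> smooth_functions A \<Longrightarrow> f + g \<in> smooth_functions A"
  unfolding smooth_functions_def plus_fun_def comp_def by (auto intro: smooth_on_add)

lemma smooth_functions_mult:
  fixes f g :: "'m \<Rightarrow> complex"
  shows "f \<in> smooth_functions A \<Longrightarrow> g \<in> smooth_functions A \<Longrightarrow> f * g \<in> smooth_functions A"
  unfolding smooth_functions_def times_fun_def comp_def by (auto intro: smooth_on_mult)

lemma smooth_functions_cmult: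
  fixes f :: "'m \<Rightarrow> complex"
  shows "f \<in> smooth_functions A \<Longrightarrow> (\<lambda>p. z * f p) \<in> smooth_functions A"
  using smooth_functions_mult[OF smooth_functions_const[of z]] by (simp add: times_fun_def)

lemma smooth_functions_sum:
  fixes f :: "'i \<Rightarrow> 'm \<Rightarrow> complex"
  assumes "\<And>i. i \<in> I \<Longrightarrow> f i \<in> smooth_functions A"
  shows "(\<Sum>i\<in>I. f i) \<in> smooth_functions A"
  using assms
  by (induction I rule: infinite_finite_induct)
    (auto intro: smooth_functions_add simp: smooth_functions_zero)

lemma smooth_functions_bounded_linear:
  fixes f :: "'m \<Rightarrow> complex" and s :: "complex \<Rightarrow> complex"
  shows "bounded_linear s \<Longrightarrow> f \<in> smooth_functions A \<Longrightarrow> (\<lambda>p. s (f p)) \<in> smooth_functions A"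
  unfolding smooth_functions_def comp_def by (auto intro: smooth_on_bounded_linear)

lemma operator_of_order_mono: "k \<le> l \<Longrightarrow> operator_of_order A k D \<Longrightarrow> operator_of_order A l D"
  unfolding operator_of_order_def by (meson local_operator_mono open_chart_image)

lemma differential_operator_id: "differential_operator A (\<lambda>f. f)"
proof -
  have "operator_of_order A 0 (\<lambda>f. f)"
    unfolding operator_of_order_def
  proof
    fix c assume c: "c \<in> A"
    have "local_operator (chart_image c) 0 (\<lambda>F :: 'e \<Rightarrow> complex. \<lambda>x. 1 * iter_partial [] F x)"
      by (intro local_operator_monomial open_chart_image smooth_on_const c) (simp add: multi_indices_def)
    with c show "\<exists>L. local_operator (chart_image c) 0 L \<and>
        (\<forall>f\<in>smooth_functions A. \<forall>p\<in>fst c. (f p :: complex) = L (f \<circ> chart_inv c) (snd c p))"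
      by (intro exI[of _ "\<lambda>F. F"]) (auto simp: chart_inv_apply)
  qed
  then show ?thesis using differential_operator_iff by blast
qed

lemma differential_operator_add:
  assumes "differential_operator A D" "differential_operator A E"
  shows "differential_operator A (\<lambda>f. D f + E f)"
proof -
  obtain k l where kl: "operator_of_order A k D" "operator_of_order A l E"
    using assms differential_operator_iff by blast
  \<comment> \<open>The common order is fixed before any chart is chosen, which keeps it uniform
    over the atlas.\<close>
  have "operator_of_order A (max k l) (\<lambda>f. D f + E f)"
    unfolding operator_of_order_def
  proof
    fix c assume c: "c \<in> A"
    have "operator_of_order A (max k l) D" "operator_of_order A (max k l) E"
      using operator_of_order_mono[OF _ kl(1)] operator_of_order_mono[OF _ kl(2)] by simp_all
    then obtain L M where "local_operator (chart_image c) (max k l) L"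
      "\<And>f p. f \<in> smooth_functions A \<Longrightarrow> p \<in> fst c \<Longrightarrow> D f p = L (f \<circ> chart_inv c) (snd c p)"
      "local_operator (chart_image c) (max k l) M"
      "\<And>f p. f \<in> smooth_functions A \<Longrightarrow> p \<in> fst c \<Longrightarrow> E f p = M (f \<circ> chart_inv c) (snd c p)"
      using operator_of_orderE c by metis
    then show "\<exists>L. local_operator (chart_image c) (max k l) L \<and>
        (\<forall>f\<in>smooth_functions A. \<forall>p\<in>fst c. (D f + E f) p = L (f \<circ> chart_inv c) (snd c p))"
      by (intro exI[of _ "\<lambda>F x. L F x + M F x"]) (auto intro: local_operator_add)
  qed
  then show ?thesis using differential_operator_iff by blast
qed

lemma differential_operator_comp:
  assumes "differential_operator A D" "differential_operator A E"
  shows "differential_operator A (\<lambda>f. D (E f))"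
proof -
  obtain k l where kl: "operator_of_order A k D" "operator_of_order A l E"
    using assms differential_operator_iff by blast
  have "operator_of_order A (k + l) (\<lambda>f. D (E f))"
    unfolding operator_of_order_def
  proof
    fix c assume c: "c \<in> A"
    obtain L M where L: "local_operator (chart_image c) k L"
      "\<And>f p. f \<in> smooth_functions A \<Longrightarrow> p \<in> fst c \<Longrightarrow> D f p = L (f \<circ> chart_inv c) (snd c p)"
      and M: "local_operator (chart_image c) l M"
      "\<And>f p. f \<in> smooth_functions A \<Longrightarrow> p \<in> fst c \<Longrightarrow> E f p = M (f \<circ> chart_inv c) (snd c p)"
      using operator_of_orderE[OF kl(1) c] operator_of_orderE[OF kl(2) c] by metis
    obtain a where a: "\<And>F x. smooth_on (chart_image c) F \<Longrightarrow> x \<in> chart_image c \<Longrightarrow>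
        L F x = (\<Sum>bs\<in>multi_indices k. a bs x * iter_partial bs F x)"
      using local_operatorE[OF L(1)] by metis
    have "D (E f) p = L (M (f \<circ> chart_inv c)) (snd c p)" if f: "f \<in> smooth_functions A" and p: "p \<in> fst c" for f p
    proof -
      have Ef: "E f \<in> smooth_functions A"
        using assms(2) f by (rule differential_operator_smooth)
      \<comment> \<open>The two functions agree only on the chart image, and L takes functions on
        the whole space as arguments. Its coefficient formula shows that only the iterated partial
        derivatives at the point matter, and these agree because the image is open.\<close>
      have "iter_partial bs (E f \<circ> chart_inv c) (snd c p) = iter_partial bs (M (f \<circ> chart_inv c)) (snd c p)" for bs
        using M(2) f p c
        by (intro iter_partial_cong[OF open_chart_image[OF c]])
          (auto simp: chart_inv_mem chart_apply_inv chart_mem_image)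
      then show ?thesis
        using L(2)[OF Ef p] a smooth_functionsD[OF Ef c] chart_mem_image[OF p] M(1)
          local_operator_smooth_on[OF open_chart_image[OF c] M(1) smooth_functionsD[OF f c]] by simp
    qed
    then show "\<exists>L. local_operator (chart_image c) (k + l) L \<and>
        (\<forall>f\<in>smooth_functions A. \<forall>p\<in>fst c. D (E f) p = L (f \<circ> chart_inv c) (snd c p))"
      using local_operator_comp[OF open_chart_image[OF c] L(1) M(1)]
      by (intro exI[of _ "\<lambda>F. L (M F)"]) auto
  qed
  then show ?thesis using differential_operator_iff by blast
qed

lemma differential_operator_cmult:
  assumes "differential_operator A D"
  shows "differential_operator A (\<lambda>f p. z * D f p)"
proof -
  obtain k where k: "operator_of_order A k D"
    using assms differential_operator_iff by blast
  have "operator_of_order A k (\<lambda>f p. z * D f p)"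
    unfolding operator_of_order_def
  proof
    fix c assume c: "c \<in> A"
    obtain L where "local_operator (chart_image c) k L"
      "\<And>f p. f \<in> smooth_functions A \<Longrightarrow> p \<in> fst c \<Longrightarrow> D f p = L (f \<circ> chart_inv c) (snd c p)"
      using operator_of_orderE[OF k c] by metis
    with c show "\<exists>L. local_operator (chart_image c) k L \<and>
        (\<forall>f\<in>smooth_functions A. \<forall>p\<in>fst c. z * D f p = L (f \<circ> chart_inv c) (snd c p))"
      by (intro exI[of _ "\<lambda>F x. z * L F x"])
        (auto intro!: local_operator_mult[where m = "\<lambda>_. z"] smooth_on_const open_chart_image)
  qed
  then show ?thesis using differential_operator_iff by blast
qed

lemma differential_operator_sum:
  assumes "\<And>i. i \<in> I \<Longrightarrow> differential_operator A (D i)"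
  shows "differential_operator A (\<lambda>f. \<Sum>i\<in>I. D i f)"
proof -
  have zero: "differential_operator A (\<lambda>f. 0)"
    using differential_operator_cmult[OF differential_operator_id, of 0] by (simp add: zero_fun_def)
  show ?thesis using assms
    by (induction I rule: infinite_finite_induct) (auto intro: differential_operator_add simp: zero)
qed

text \<open>The map s commutes with partial derivatives, being real linear and bounded, and it is
  multiplicative and involutive. Hence the inner s cancels against the outer one and only the
  coefficients change, from \<open>a bs\<close> to their images under s.\<close>

lemma differential_operator_conjugate:
  assumes D: "differential_operator A D"
    and s: "bounded_linear s" "\<And>z w. s (z * w) = s z * s w" "\<And>z. s (s z) = z"
  shows "differential_operator A (\<lambda>f p. s (D (\<lambda>q. s (f q)) p))"
proof -
  obtain k where k: "operator_of_order A k D"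
    using D differential_operator_iff by blast
  have "operator_of_order A k (\<lambda>f p. s (D (\<lambda>q. s (f q)) p))"
    unfolding operator_of_order_def
  proof
    fix c assume c: "c \<in> A"
    obtain L where L: "local_operator (chart_image c) k L"
      "\<And>f p. f \<in> smooth_functions A \<Longrightarrow> p \<in> fst c \<Longrightarrow> D f p = L (f \<circ> chart_inv c) (snd c p)"
      using operator_of_orderE[OF k c] by metis
    obtain a where a: "\<And>bs. bs \<in> multi_indices k \<Longrightarrow> smooth_on (chart_image c) (a bs)"
      "\<And>F x. smooth_on (chart_image c) F \<Longrightarrow> x \<in> chart_image c \<Longrightarrow>
        L F x = (\<Sum>bs\<in>multi_indices k. a bs x * iter_partial bs F x)"
      using local_operatorE[OF L(1)] by metis
    have "s (L (\<lambda>x. s (F x)) x) = (\<Sum>bs\<in>multi_indices k. s (a bs x) * iter_partial bs F x)"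
      if "smooth_on (chart_image c) F" "x \<in> chart_image c" for F x
    proof -
      have "L (\<lambda>x. s (F x)) x = (\<Sum>bs\<in>multi_indices k. a bs x * s (iter_partial bs F x))"
        using that smooth_on_bounded_linear[OF s(1) that(1)]
        by (auto simp: a(2) iter_partial_bounded_linear[OF s(1)] multi_indices_set intro!: sum.cong)
      then show ?thesis
        by (simp add: linear_sum[OF bounded_linear.linear[OF s(1)]] s(2,3))
    qed
    then have "local_operator (chart_image c) k (\<lambda>F x. s (L (\<lambda>x. s (F x)) x))"
      unfolding local_operator_def
      by (intro exI[of _ "\<lambda>bs x. s (a bs x)"]) (auto intro: smooth_on_bounded_linear s a)
    then show "\<exists>L. local_operator (chart_image c) k L \<and>
        (\<forall>f\<in>smooth_functions A. \<forall>p\<in>fst c. s (D (\<lambda>q. s (f q)) p) = L (f \<circ> chart_inv c) (snd c p))"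
      using L(2) smooth_functions_bounded_linear[OF s(1)]
      by (intro exI[of _ "\<lambda>F x. s (L (\<lambda>x. s (F x)) x)"]) (auto simp: comp_def)
  qed
  then show ?thesis using differential_operator_iff by blast
qed

text \<open>Linearity is not a clause of \<open>differential_operator\<close>; it is read off from
  the coefficient formula in a chart around each point, and so is available on smooth arguments
  only.\<close>

lemma differential_operator_apply_add:
  assumes "differential_operator A D" "f \<in> smooth_functions A" "g \<in> smooth_functions A"
  shows "D (f + g) = D f + D g"
proof
  fix p
  obtain c where c: "c \<in> A" "p \<in> fst c" by (rule in_chart)
  obtain k where "operator_of_order A k D"
    using assms differential_operator_iff by blast
  then obtain L where L: "local_operator (chart_image c) k L"
    "\<And>f p. f \<in> smooth_functions A \<Longrightarrow> p \<in> fst c \<Longrightarrow> D f p = L (f \<circ> chart_inv c) (snd c p)"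
    using operator_of_orderE c(1) by metis
  obtain a where a: "\<And>F x. smooth_on (chart_image c) F \<Longrightarrow> x \<in> chart_image c \<Longrightarrow>
      L F x = (\<Sum>bs\<in>multi_indices k. a bs x * iter_partial bs F x)"
    using local_operatorE[OF L(1)] by metis
  have sm: "smooth_on (chart_image c) (f \<circ> chart_inv c)" "smooth_on (chart_image c) (g \<circ> chart_inv c)"
    by (intro smooth_functionsD assms c)+
  have "(f + g) \<circ> chart_inv c = (\<lambda>x. (f \<circ> chart_inv c) x + (g \<circ> chart_inv c) x)"
    by auto
  then show "D (f + g) p = (D f + D g) p"
    using L(2) assms c sm smooth_functions_add
    by (simp add: a chart_mem_image smooth_on_add iter_partial_add multi_indices_set distrib_left
        sum.distrib del: comp_apply)
qed

lemma differential_operator_apply_cmult: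
  assumes "differential_operator A D" "f \<in> smooth_functions A"
  shows "D (\<lambda>p. z * f p) = (\<lambda>p. z * D f p)"
proof
  fix p
  obtain c where c: "c \<in> A" "p \<in> fst c" by (rule in_chart)
  obtain k where "operator_of_order A k D"
    using assms differential_operator_iff by blast
  then obtain L where L: "local_operator (chart_image c) k L"
    "\<And>f p. f \<in> smooth_functions A \<Longrightarrow> p \<in> fst c \<Longrightarrow> D f p = L (f \<circ> chart_inv c) (snd c p)"
    using operator_of_orderE c(1) by metis
  obtain a where a: "\<And>F x. smooth_on (chart_image c) F \<Longrightarrow> x \<in> chart_image c \<Longrightarrow>
      L F x = (\<Sum>bs\<in>multi_indices k. a bs x * iter_partial bs F x)"
    using local_operatorE[OF L(1)] by metis
  have sm: "smooth_on (chart_image c) (f \<circ> chart_inv c)"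
    by (intro smooth_functionsD assms c)+
  then have "smooth_on (chart_image c) (\<lambda>x. z * (f \<circ> chart_inv c) x)"
    using c by (intro smooth_on_mult smooth_on_const open_chart_image)
  moreover have "(\<lambda>p. z * f p) \<circ> chart_inv c = (\<lambda>x. z * (f \<circ> chart_inv c) x)"
    by auto
  ultimately show "D (\<lambda>p. z * f p) p = z * D f p"
    using L(2) assms c sm smooth_functions_cmult
    by (simp add: a chart_mem_image iter_partial_cmult multi_indices_set sum_distrib_left
        mult.left_commute del: comp_apply)
qed

lemma differential_operator_apply_zero: "differential_operator A D \<Longrightarrow> D 0 = 0"
  using differential_operator_apply_cmult[of D 0 0] smooth_functions_zero
  by (simp add: zero_fun_def)

lemma differential_operator_apply_sum:
  assumes "differential_operator A D" "\<And>i. i \<in> I \<Longrightarrow> f i \<in> smooth_functions A"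
  shows "D (\<Sum>i\<in>I. f i) = (\<Sum>i\<in>I. D (f i))"
  using assms(2)
  by (induction I rule: infinite_finite_induct)
    (auto simp: differential_operator_apply_zero differential_operator_apply_add assms(1) smooth_functions_sum)

end

section \<open>Formal series of differential operators\<close>

definition formal_op ::
  "(nat \<Rightarrow> ('m \<Rightarrow> complex) \<Rightarrow> 'm \<Rightarrow> complex) \<Rightarrow> ('m \<Rightarrow> complex) fps \<Rightarrow> ('m \<Rightarrow> complex) fps" where
  "formal_op D f = Abs_fps (\<lambda>n. \<Sum>i\<le>n. D i (fps_nth f (n - i)))"

definition unital_series ::
  "('m, 'e::euclidean_space) chart set \<Rightarrow> (nat \<Rightarrow> ('m \<Rightarrow> complex) \<Rightarrow> 'm \<Rightarrow> complex) \<Rightarrow> bool" where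
  "unital_series A D \<longleftrightarrow> (\<forall>i. differential_operator A (D i)) \<and> D 0 = (\<lambda>f. f)"

definition comp_series ::
  "(nat \<Rightarrow> 'a \<Rightarrow> 'm \<Rightarrow> complex) \<Rightarrow> (nat \<Rightarrow> 'b \<Rightarrow> 'a) \<Rightarrow> nat \<Rightarrow> 'b \<Rightarrow> 'm \<Rightarrow> complex" where
  "comp_series D E n f = (\<Sum>i\<le>n. D i (E (n - i) f))"

text \<open>The unique solutions of \<open>S X = T\<close> and \<open>X X = Q\<close> when \<open>S\<close> and \<open>Q\<close> start with the identity.\<close>

fun quotient_series ::
  "(nat \<Rightarrow> ('m \<Rightarrow> complex) \<Rightarrow> 'm \<Rightarrow> complex) \<Rightarrow> (nat \<Rightarrow> ('m \<Rightarrow> complex) \<Rightarrow> 'm \<Rightarrow> complex) \<Rightarrow>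
   nat \<Rightarrow> ('m \<Rightarrow> complex) \<Rightarrow> 'm \<Rightarrow> complex" where
  "quotient_series S T n = (\<lambda>f. T n f - (\<Sum>i\<in>{1..n}. S i (quotient_series S T (n - i) f)))"

fun root_series ::
  "(nat \<Rightarrow> ('m \<Rightarrow> complex) \<Rightarrow> 'm \<Rightarrow> complex) \<Rightarrow> nat \<Rightarrow> ('m \<Rightarrow> complex) \<Rightarrow> 'm \<Rightarrow> complex" where
  "root_series Q n = (if n = 0 then (\<lambda>f. f)
     else (\<lambda>f p. (1/2) * (Q n f - (\<Sum>i\<in>{1..<n}. root_series Q i (root_series Q (n - i) f))) p))"

declare quotient_series.simps [simp del] root_series.simps [simp del]

text \<open>Taking \<open>s\<close> to be \<open>cnj\<close> or the identity treats \<open>C\<close> and \<open>P\<close> simultaneously.\<close>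

definition real_involution :: "(complex \<Rightarrow> complex) \<Rightarrow> bool" where
  "real_involution s \<longleftrightarrow> bounded_linear s \<and> (\<forall>z w. s (z * w) = s z * s w) \<and> (\<forall>z. s (s z) = z)"

definition formal_twist :: "(complex \<Rightarrow> complex) \<Rightarrow> ('m \<Rightarrow> complex) fps \<Rightarrow> ('m \<Rightarrow> complex) fps" where
  "formal_twist s f = Abs_fps (\<lambda>n p. (-1) ^ n * s (fps_nth f n p))"

definition twist_series ::
  "(complex \<Rightarrow> complex) \<Rightarrow> (nat \<Rightarrow> ('m \<Rightarrow> complex) \<Rightarrow> 'm \<Rightarrow> complex) \<Rightarrow>
   nat \<Rightarrow> ('m \<Rightarrow> complex) \<Rightarrow> 'm \<Rightarrow> complex" where
  "twist_series s D i f = (\<lambda>p. (-1) ^ i * s (D i (\<lambda>q. s (f q)) p))"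

lemma formal_conj_eq_twist: "formal_conj = formal_twist cnj"
  by (simp add: fun_eq_iff formal_conj_def formal_twist_def)

lemma formal_parity_eq_twist: "formal_parity = formal_twist (\<lambda>z. z)"
  by (simp add: fun_eq_iff formal_parity_def formal_twist_def)

lemma real_involution_cnj: "real_involution cnj"
  by (simp add: real_involution_def bounded_linear_cnj)

lemma real_involution_id: "real_involution (\<lambda>z. z)"
  by (simp add: real_involution_def bounded_linear_ident)

lemma real_involution_sign:
  assumes "real_involution s"
  shows "s ((-1) ^ n * z) = (-1) ^ n * s z"
proof -
  have "linear s"
    using assms by (simp add: real_involution_def bounded_linear.linear)
  then show ?thesis
    by (cases "even n") (simp_all add: linear_neg)
qed

lemma formal_twist_nth: "fps_nth (formal_twist s f) n = (\<lambda>p. (-1) ^ n * s (fps_nth f n p))"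
  by (simp add: formal_twist_def)

lemma formal_twist_twist:
  assumes "real_involution s"
  shows "formal_twist s (formal_twist s f) = f"
proof -
  have "(-1) ^ n * ((-1) ^ n * z) = (z::complex)" for n z
    by (simp flip: mult.assoc power_mult_distrib)
  then show ?thesis
    using assms
    by (intro fps_ext ext) (simp only: formal_twist_nth real_involution_sign, simp add: real_involution_def)
qed

lemma formal_twist_commute:
  assumes "real_involution s" "real_involution d" "\<And>z. s (d z) = d (s z)"
  shows "formal_twist s (formal_twist d f) = formal_twist d (formal_twist s f)"
  by (intro fps_ext ext) (simp add: formal_twist_nth real_involution_sign assms)

section \<open>Multiplication by the formal parameter and rearrangement of double sums\<close>

lemma fps_X_mult_shift:
  fixes f :: "('m \<Rightarrow> complex) fps"
  assumes "fps_nth f 0 = 0"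
  shows "f = fps_X * fps_shift 1 f"
  using assms by (intro fps_ext) (simp add: zero_fun_def)

lemma formal_scale_nth: "fps_nth (formal_scale \<alpha> f) n = (\<Sum>i\<le>n. (\<lambda>p. fps_nth \<alpha> i * fps_nth f (n - i) p))"
  by (simp add: formal_scale_def fps_mult_nth atMost_atLeast0 times_fun_def)

text \<open>Turns linearity over formal scalars into commutation with \<open>fps_X\<close>, the form
  in which all arguments by order in \<nu> use it.\<close>

lemma formal_scale_X: "formal_scale fps_X f = fps_X * f"
proof -
  have "Abs_fps (\<lambda>n p. fps_nth fps_X n) = (fps_X :: ('m \<Rightarrow> complex) fps)"
    by (intro fps_ext ext) (simp add: zero_fun_def one_fun_def)
  then show ?thesis unfolding formal_scale_def by (rule arg_cong)
qed

lemma sum_fun_apply: "(\<Sum>i\<in>I. f i) x = (\<Sum>i\<in>I. f i x)"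
  for f :: "'i \<Rightarrow> 'a \<Rightarrow> 'b::comm_monoid_add"
  by (induction I rule: infinite_finite_induct) auto

lemma sum_triangle_swap:
  fixes F :: "nat \<Rightarrow> nat \<Rightarrow> 'a::comm_monoid_add"
  shows "(\<Sum>i\<le>n. \<Sum>j\<le>n - i. F i j) = (\<Sum>j\<le>n. \<Sum>i\<le>n - j. F i j)"
proof -
  have "{j. j \<in> {..n} \<and> i + j \<le> n} = {..n - i}" "{j. j \<in> {..n} \<and> j + i \<le> n} = {..n - i}" if "i \<le> n" for i
    using that by auto
  then show ?thesis
    using sum.swap_restrict[of "{..n}" "{..n}" F "\<lambda>i j. i + j \<le> n"] by simp
qed

text \<open>Pairs are grouped by m = i + j. This collects the contributions to one coefficient of a
  composition of series.\<close>

lemma sum_triangle_diagonal: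
  fixes F :: "nat \<Rightarrow> nat \<Rightarrow> 'a::comm_monoid_add"
  shows "(\<Sum>i\<le>n. \<Sum>j\<le>n - i. F i j) = (\<Sum>m\<le>n. \<Sum>i\<le>m. F i (m - i))"
  unfolding sum.Sigma[OF finite_atMost ballI[OF finite_atMost]]
  by (rule sum.reindex_bij_witness[where j = "\<lambda>(i, j). (i + j, i)" and i = "\<lambda>(m, i). (i, m - i)"]) auto

lemma formal_op_unital:
  assumes "D 0 = (\<lambda>f. f)"
  shows "formal_op D f = Abs_fps (\<lambda>n. fps_nth f n + (\<Sum>i=1..n. D i (fps_nth f (n - i))))"
  by (intro fps_ext) (simp add: formal_op_def assms atMost_atLeast0 sum.atLeast_Suc_atMost)

context smooth_manifold
begin

lemma formal_functions_add:
  "f \<in> formal_functions A \<Longrightarrow> g \<in> formal_functions A \<Longrightarrow> f + g \<in> formal_functions A"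
  by (simp add: formal_functions_def smooth_functions_add)

lemma smooth_functions_diff:
  fixes f g :: "'m \<Rightarrow> complex"
  assumes "f \<in> smooth_functions A" "g \<in> smooth_functions A"
  shows "f - g \<in> smooth_functions A"
  using smooth_functions_add[OF assms(1) smooth_functions_cmult[OF assms(2), of "-1"]]
  by (simp add: plus_fun_def fun_diff_def)

lemma formal_functions_diff:
  "f \<in> formal_functions A \<Longrightarrow> g \<in> formal_functions A \<Longrightarrow> f - g \<in> formal_functions A"
  by (simp add: formal_functions_def smooth_functions_diff)

lemma formal_functions_X: "f \<in> formal_functions A \<Longrightarrow> fps_X * f \<in> formal_functions A"
  by (simp add: formal_functions_def smooth_functions_zero)

lemma formal_functions_shift: "f \<in> formal_functions A \<Longrightarrow> fps_shift k f \<in> formal_functions A"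
  by (simp add: formal_functions_def)

lemma formal_functions_twist:
  "real_involution s \<Longrightarrow> f \<in> formal_functions A \<Longrightarrow> formal_twist s f \<in> formal_functions A"
  by (simp add: formal_functions_def formal_twist_nth real_involution_def smooth_functions_cmult
      smooth_functions_bounded_linear)

section \<open>Operators that are the identity modulo the formal parameter\<close>

text \<open>Abstracts from differential operators to additive maps that commute with \<nu> and
  induce the identity modulo \<nu>. The uniqueness arguments live at this level, where composites
  need no explicit coefficients.\<close>

definition near_identity :: "(('m \<Rightarrow> complex) fps \<Rightarrow> ('m \<Rightarrow> complex) fps) \<Rightarrow> bool" where
  "near_identity Q \<longleftrightarrow>
     (\<forall>f\<in>formal_functions A. Q f \<in> formal_functions A) \<and>
     (\<forall>f\<in>formal_functions A. \<forall>g\<in>formal_functions A. Q (f + g) = Q f + Q g) \<and>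
     (\<forall>f\<in>formal_functions A. Q (fps_X * f) = fps_X * Q f) \<and>
     (\<forall>f\<in>formal_functions A. fps_nth (Q f) 0 = fps_nth f 0)"

lemma near_identity_closed: "near_identity Q \<Longrightarrow> f \<in> formal_functions A \<Longrightarrow> Q f \<in> formal_functions A"
  by (simp add: near_identity_def)

lemma near_identity_id: "near_identity (\<lambda>f. f)"
  by (simp add: near_identity_def)

lemma near_identity_comp: "near_identity P \<Longrightarrow> near_identity Q \<Longrightarrow> near_identity (\<lambda>f. P (Q f))"
  by (simp add: near_identity_def)

lemma near_identity_diff:
  assumes "near_identity Q" "f \<in> formal_functions A" "g \<in> formal_functions A"
  shows "Q (f - g) = Q f - Q g"
proof -
  have "Q ((f - g) + g) = Q (f - g) + Q g"
    using assms formal_functions_diff unfolding near_identity_def by blast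
  then show ?thesis by simp
qed

lemma near_identity_expand:
  assumes "near_identity Q" "f \<in> formal_functions A"
  obtains h where "h \<in> formal_functions A" "Q f = f + fps_X * h"
proof
  show "fps_shift 1 (Q f - f) \<in> formal_functions A"
    using assms by (intro formal_functions_shift formal_functions_diff) (auto simp: near_identity_def)
  have "Q f - f = fps_X * fps_shift 1 (Q f - f)"
    using assms by (intro fps_X_mult_shift) (simp add: near_identity_def)
  then show "Q f = f + fps_X * fps_shift 1 (Q f - f)"
    by (metis add.commute diff_add_cancel)
qed

text \<open>Such a w is divisible by the n-th power of \<nu>. The induction pulls one factor \<nu>
  at a time through Q, until the agreement of constant coefficients applies.\<close>

lemma near_identity_leading:
  assumes "near_identity Q" "w \<in> formal_functions A" "\<And>m. m < n \<Longrightarrow> fps_nth w m = 0"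
  shows "fps_nth (Q w) n = fps_nth w n"
  using assms(2,3)
proof (induction n arbitrary: w)
  case 0
  then show ?case using assms(1) by (simp add: near_identity_def)
next
  case (Suc n)
  have w: "w = fps_X * fps_shift 1 w"
    by (rule fps_X_mult_shift) (rule Suc.prems(2), simp)
  have sh: "fps_shift 1 w \<in> formal_functions A"
    using Suc.prems(1) by (rule formal_functions_shift)
  then have "Q w = fps_X * Q (fps_shift 1 w)"
    using assms(1) w unfolding near_identity_def by metis
  then have "fps_nth (Q w) (Suc n) = fps_nth (Q (fps_shift 1 w)) n"
    by simp
  also have "\<dots> = fps_nth w (Suc n)"
    using Suc.IH[OF sh] Suc.prems(2) by simp
  finally show ?case .
qed

text \<open>If f - g were nonzero, its lowest nonzero coefficient would survive in Q (f - g) =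
  0.\<close>

lemma near_identity_inject:
  assumes "near_identity Q" "f \<in> formal_functions A" "g \<in> formal_functions A" "Q f = Q g"
  shows "f = g"
proof -
  have w: "f - g \<in> formal_functions A" "Q (f - g) = 0"
    using assms by (simp_all add: formal_functions_diff near_identity_diff)
  have "fps_nth (f - g) n = 0" for n
  proof (induction n rule: less_induct)
    case (less n)
    then show ?case using near_identity_leading[OF assms(1) w(1), of n] unfolding w(2) by (metis fps_zero_nth)
  qed
  then have "f - g = 0" by (intro fps_ext) simp
  then show ?thesis by simp
qed

text \<open>P and Q preserve leading coefficients, and \<open>step\<close> makes those of
  \<open>W (y i)\<close> and \<open>W i\<close> equal, so \<open>rel\<close> reads as twice the
  leading coefficient being zero. The induction on n runs over the whole family at once because
  \<open>step\<close> needs vanishing below n for all indices. The index set accommodates single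
  series as well as pairs of series.\<close>

lemma doubling_zero:
  assumes "near_identity P" "near_identity Q"
    and y: "\<And>i. i \<in> H \<Longrightarrow> y i \<in> H"
    and W: "\<And>i. i \<in> H \<Longrightarrow> W i \<in> formal_functions A"
    and rel: "\<And>i. i \<in> H \<Longrightarrow> P (W (y i)) + Q (W i) = 0"
    and step: "\<And>n i. i \<in> H \<Longrightarrow> (\<And>j m. j \<in> H \<Longrightarrow> m < n \<Longrightarrow> fps_nth (W j) m = 0) \<Longrightarrow>
      fps_nth (W (y i)) n = fps_nth (W i) n"
    and i: "i \<in> H"
  shows "W i = 0"
proof -
  have "\<forall>i\<in>H. fps_nth (W i) n = 0" for n
  proof (induction n rule: less_induct)
    case (less n)
    show ?case
    proof
      fix i assume i: "i \<in> H"
      have low: "fps_nth (W j) m = 0" if "j \<in> H" "m < n" for j m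
        using less that by blast
      have "fps_nth (P (W (y i))) n = fps_nth (W (y i)) n" "fps_nth (Q (W i)) n = fps_nth (W i) n"
        by (rule near_identity_leading; use assms(1,2) W low y i in blast)+
      moreover have "fps_nth (W (y i)) n = fps_nth (W i) n"
        using step[OF i] low by blast
      moreover have "fps_nth (P (W (y i))) n + fps_nth (Q (W i)) n = 0"
        using arg_cong[OF rel[OF i], of "\<lambda>f. fps_nth f n"] by simp
      \<comment> \<open>Evaluated at a point this is an equation 2z = 0 between complex
        numbers.\<close>
      ultimately have "fps_nth (W i) n p + fps_nth (W i) n p = 0" for p
        by (metis plus_fun_apply zero_fun_apply)
      then show "fps_nth (W i) n = 0"
        by (intro ext) simp
    qed
  qed
  then show ?thesis using i by (intro fps_ext) simp
qed

text \<open>Supplies the \<open>step\<close> premise of \<open>doubling_zero\<close> for W = P - Q: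
  writing Y f = f + \<nu> h gives W (Y f) = W f + \<nu> W h, and the extra term has order above n -
  1.\<close>

lemma near_identity_difference_step:
  assumes PQ: "near_identity P" "near_identity Q" and Y: "near_identity Y" and f: "f \<in> formal_functions A"
    and low: "\<And>g m. g \<in> formal_functions A \<Longrightarrow> m < n \<Longrightarrow> fps_nth (P g - Q g) m = 0"
  shows "fps_nth (P (Y f) - Q (Y f)) n = fps_nth (P f - Q f) n"
proof -
  obtain h where h: "h \<in> formal_functions A" "Y f = f + fps_X * h"
    using near_identity_expand[OF Y f] .
  have "R (Y f) = R f + fps_X * R h" if "near_identity R" for R
    using that h f formal_functions_X unfolding near_identity_def by metis
  then have "P (Y f) - Q (Y f) = P f - Q f + fps_X * (P h - Q h)"
    using PQ by (simp add: algebra_simps)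
  \<comment> \<open>At n = 0 the factor \<nu> makes the extra coefficient zero; otherwise n - 1 < n
    and \<open>low\<close> applies.\<close>
  then show ?thesis
    using low[OF h(1), of "n - 1"] by simp
qed

text \<open>The difference W = B - B' satisfies W B' + B W = B B - B' B' = 0, since the mixed terms
  B B' cancel. No commutation of B with B' is involved.\<close>

lemma square_root_unique:
  assumes B: "near_identity B" "near_identity B'"
    and sq: "\<And>f. f \<in> formal_functions A \<Longrightarrow> B (B f) = B' (B' f)"
    and f: "f \<in> formal_functions A"
  shows "B f = B' f"
proof -
  have "B f - B' f = 0"
  proof (rule doubling_zero[where H = "formal_functions A" and W = "\<lambda>f. B f - B' f" and y = B' and i = f,
        OF near_identity_id B(1)])
    show "B (B' f) - B' (B' f) + B (B f - B' f) = 0" if "f \<in> formal_functions A" for f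
      using that by (simp add: near_identity_diff B near_identity_closed sq)
    show "fps_nth (B (B' f) - B' (B' f)) n = fps_nth (B f - B' f) n"
      if "f \<in> formal_functions A"
        "\<And>j m. j \<in> formal_functions A \<Longrightarrow> m < n \<Longrightarrow> fps_nth (B j - B' j) m = 0" for f n
      using near_identity_difference_step[OF B B(2)] that by blast
  qed (use f B in \<open>auto intro: near_identity_closed formal_functions_diff\<close>)
  then show ?thesis by simp
qed

text \<open>For W = B B' - id one finds B W B' + W = B B B' B' - id = 0, since B B' occurs with both
  signs.\<close>

lemma square_root_inverse:
  assumes B: "near_identity B" "near_identity B'"
    and sq: "\<And>f. f \<in> formal_functions A \<Longrightarrow> B (B (B' (B' f))) = f"
    and f: "f \<in> formal_functions A"
  shows "B (B' f) = f"
proof -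
  have "B (B' f) - f = 0"
  proof (rule doubling_zero[where H = "formal_functions A" and W = "\<lambda>f. B (B' f) - f" and y = B' and i = f,
        OF B(1) near_identity_id])
    show "B (B (B' (B' f)) - B' f) + (B (B' f) - f) = 0" if "f \<in> formal_functions A" for f
      using that by (simp add: near_identity_diff B near_identity_closed sq)
    show "fps_nth (B (B' (B' f)) - B' f) n = fps_nth (B (B' f) - f) n"
      if "f \<in> formal_functions A"
        "\<And>j m. j \<in> formal_functions A \<Longrightarrow> m < n \<Longrightarrow> fps_nth (B (B' j) - j) m = 0" for f n
      using near_identity_difference_step[OF near_identity_comp[OF B] near_identity_id B(2)] that by blast
  qed (use f B in \<open>auto intro: near_identity_closed formal_functions_diff\<close>)
  then show ?thesis by simp
qed

section \<open>Products on formal functions and square roots of automorphisms\<close>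

definition formal_product ::
  "(('m \<Rightarrow> complex) fps \<Rightarrow> ('m \<Rightarrow> complex) fps \<Rightarrow> ('m \<Rightarrow> complex) fps) \<Rightarrow> bool" where
  "formal_product star \<longleftrightarrow>
     (\<forall>f\<in>formal_functions A. \<forall>g\<in>formal_functions A. star f g \<in> formal_functions A) \<and>
     (\<forall>f\<in>formal_functions A. \<forall>g\<in>formal_functions A. \<forall>h\<in>formal_functions A.
        star (f + g) h = star f h + star g h \<and> star h (f + g) = star h f + star h g) \<and>
     (\<forall>f\<in>formal_functions A. \<forall>g\<in>formal_functions A.
        star (fps_X * f) g = fps_X * star f g \<and> star f (fps_X * g) = fps_X * star f g)"

lemma formal_product_closed:
  "formal_product star \<Longrightarrow> f \<in> formal_functions A \<Longrightarrow> g \<in> formal_functions A \<Longrightarrow>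
    star f g \<in> formal_functions A"
  by (simp add: formal_product_def)

lemma star_product_imp_formal_product:
  assumes "star_product A \<omega> star"
  shows "formal_product star"
  unfolding formal_product_def
proof (intro conjI ballI)
  fix f g :: "('m \<Rightarrow> complex) fps" assume fg: "f \<in> formal_functions A" "g \<in> formal_functions A"
  show "star f g \<in> formal_functions A"
    using assms fg unfolding star_product_def by (elim conjE) simp
  show "star (fps_X * f) g = fps_X * star f g" "star f (fps_X * g) = fps_X * star f g"
    using assms fg unfolding star_product_def by (elim conjE; metis formal_scale_X)+
  fix h :: "('m \<Rightarrow> complex) fps" assume "h \<in> formal_functions A"
  then show "star (f + g) h = star f h + star g h" "star h (f + g) = star h f + star h g"
    using assms fg unfolding star_product_def by (elim conjE; simp)+
qed

text \<open>The defect E satisfies E (B f) (B g) + B (E f g) = 0: the terms B (Bf \<star> Bg)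
  cancel, and the rest vanishes because B B is multiplicative. So doubling applies with y = B
  \<times> B.\<close>

lemma square_root_multiplicative:
  assumes B: "near_identity B" and star: "formal_product star"
    and sq: "\<And>f g. f \<in> formal_functions A \<Longrightarrow> g \<in> formal_functions A \<Longrightarrow>
      B (B (star f g)) = star (B (B f)) (B (B g))"
    and fg: "f \<in> formal_functions A" "g \<in> formal_functions A"
  shows "B (star f g) = star (B f) (B g)"
proof -
  define E where "E f g = B (star f g) - star (B f) (B g)" for f g
  note closed = near_identity_closed[OF B] formal_product_closed[OF star] formal_functions_diff
    formal_functions_add formal_functions_X
  note B_lin = near_identity_diff[OF B] B[unfolded near_identity_def]
  have E_add: "E (f + g) h = E f h + E g h" "E h (f + g) = E h f + E h g"
    and E_X: "E (fps_X * f) g = fps_X * E f g" "E f (fps_X * g) = fps_X * E f g"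
    if "f \<in> formal_functions A" "g \<in> formal_functions A" "h \<in> formal_functions A" for f g h
    using that star B_lin unfolding E_def formal_product_def
    by (simp_all add: add_diff_add right_diff_distrib)
  \<comment> \<open>The defect is uncurried so that pairs can serve as indices in
    \<open>doubling_zero\<close>.\<close>
  define W where "W = (\<lambda>(f, g). E f g)"
  define y where "y = map_prod B B"
  let ?H = "formal_functions A \<times> formal_functions A"
  have "W (f, g) = 0"
  proof (rule doubling_zero[where H = ?H and W = W and y = y and i = "(f, g)",
        OF near_identity_id B])
    show "W (y i) + B (W i) = 0" if "i \<in> ?H" for i
      using that by (auto simp: W_def y_def E_def closed B_lin(1) sq)
    show "fps_nth (W (y i)) n = fps_nth (W i) n"
      if i: "i \<in> ?H" and low: "\<And>j m. j \<in> ?H \<Longrightarrow> m < n \<Longrightarrow> fps_nth (W j) m = 0" for i n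
    proof -
      obtain u v where uv: "i = (u, v)" "u \<in> formal_functions A" "v \<in> formal_functions A"
        using i by auto
      obtain u' v' where u': "u' \<in> formal_functions A" "B u = u + fps_X * u'"
        and v': "v' \<in> formal_functions A" "B v = v + fps_X * v'"
        using near_identity_expand[OF B] uv by metis
      \<comment> \<open>Expand the first argument while the second is still B v, then expand the
        second: E (B u) (B v) = E u v + \<nu> E u v' + \<nu> E u' (B v).\<close>
      have "W (y i) = W i + fps_X * (W (u, v') + W (u', B v))"
        using uv u' v' unfolding W_def y_def
        by (simp add: E_add E_X closed algebra_simps)
      moreover have "fps_nth (W (u, v') + W (u', B v)) m = 0" if "m < n" for m
        using low[of "(u, v')" m] low[of "(u', B v)" m] that uv u' v' closed(1)[of v] by (metis SigmaI add_0 fps_add_nth)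
      ultimately show ?thesis
        by (cases n) simp_all
    qed
  qed (use fg in \<open>auto simp: W_def y_def E_def intro!: closed\<close>)
  then show ?thesis by (simp add: W_def E_def)
qed

section \<open>Square roots of series of differential operators\<close>

lemma differential_operator_diff:
  assumes "differential_operator A D" "differential_operator A E"
  shows "differential_operator A (\<lambda>f. D f - E f)"
  using differential_operator_add[OF assms(1) differential_operator_cmult[OF assms(2), of "-1"]]
  by (simp add: plus_fun_def fun_diff_def)

lemma formal_op_closed:
  assumes "\<And>i. differential_operator A (D i)" "f \<in> formal_functions A"
  shows "formal_op D f \<in> formal_functions A"
  using assms(2) differential_operator_smooth[OF assms(1)]
  by (simp add: formal_functions_def formal_op_def smooth_functions_sum)

lemma formal_op_add:
  assumes "\<And>i. differential_operator A (D i)" "f \<in> formal_functions A" "g \<in> formal_functions A"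
  shows "formal_op D (f + g) = formal_op D f + formal_op D g"
proof (rule fps_ext)
  fix n
  have "D i (fps_nth f (n - i) + fps_nth g (n - i)) = D i (fps_nth f (n - i)) + D i (fps_nth g (n - i))" for i
    using assms by (intro differential_operator_apply_add) (auto simp: formal_functions_def)
  then show "fps_nth (formal_op D (f + g)) n = fps_nth (formal_op D f + formal_op D g) n"
    by (simp only: formal_op_def fps_nth_Abs_fps fps_add_nth sum.distrib)
qed

text \<open>Both sides are the same triangular double sum, with the summation over operator
  coefficients and the one over scalar coefficients interchanged.\<close>

lemma formal_op_scale:
  assumes D: "\<And>i. differential_operator A (D i)" and f: "f \<in> formal_functions A"
  shows "formal_op D (formal_scale \<alpha> f) = formal_scale \<alpha> (formal_op D f)"
proof (rule fps_ext)
  fix n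
  have sm: "fps_nth f i \<in> smooth_functions A" for i
    using f by (simp add: formal_functions_def)
  have "fps_nth (formal_op D (formal_scale \<alpha> f)) n
      = (\<Sum>i\<le>n. \<Sum>j\<le>n - i. (\<lambda>p. fps_nth \<alpha> j * D i (fps_nth f (n - i - j)) p))"
    by (simp add: formal_op_def formal_scale_nth differential_operator_apply_sum D sm
        smooth_functions_cmult differential_operator_apply_cmult)
  also have "\<dots> = (\<Sum>j\<le>n. \<Sum>i\<le>n - j. (\<lambda>p. fps_nth \<alpha> j * D i (fps_nth f (n - i - j)) p))"
    by (rule sum_triangle_swap)
  also have "\<dots> = fps_nth (formal_scale \<alpha> (formal_op D f)) n"
    unfolding formal_scale_nth
    by (intro sum.cong refl ext) (simp add: formal_op_def sum_distrib_left sum_fun_apply add.commute)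
  finally show "fps_nth (formal_op D (formal_scale \<alpha> f)) n = fps_nth (formal_scale \<alpha> (formal_op D f)) n" .
qed

lemma near_identity_formal_op:
  assumes "unital_series A D"
  shows "near_identity (formal_op D)"
proof -
  have D: "\<And>i. differential_operator A (D i)" "D 0 = (\<lambda>f. f)"
    using assms by (auto simp: unital_series_def)
  show ?thesis
    unfolding near_identity_def
    by (auto simp: formal_op_closed formal_op_add formal_op_scale D simp flip: formal_scale_X)
      (simp add: formal_op_def D)
qed

lemma formal_op_comp:
  assumes D: "\<And>i. differential_operator A (D i)" and E: "\<And>i. differential_operator A (E i)"
    and f: "f \<in> formal_functions A"
  shows "formal_op D (formal_op E f) = formal_op (comp_series D E) f"
proof (rule fps_ext)
  fix n
  have sm: "fps_nth f i \<in> smooth_functions A" for i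
    using f by (simp add: formal_functions_def)
  have "fps_nth (formal_op D (formal_op E f)) n = (\<Sum>i\<le>n. \<Sum>j\<le>n - i. D i (E j (fps_nth f (n - (i + j)))))"
    by (simp add: formal_op_def differential_operator_apply_sum differential_operator_smooth D E sm)
  also have "\<dots> = (\<Sum>m\<le>n. \<Sum>i\<le>m. D i (E (m - i) (fps_nth f (n - m))))"
    by (subst sum_triangle_diagonal) simp
  also have "\<dots> = fps_nth (formal_op (comp_series D E) f) n"
    by (simp add: formal_op_def comp_series_def)
  finally show "fps_nth (formal_op D (formal_op E f)) n = fps_nth (formal_op (comp_series D E) f) n" .
qed

lemma unital_series_comp:
  assumes "unital_series A D" "unital_series A E"
  shows "unital_series A (comp_series D E)"
proof -
  have "differential_operator A (\<lambda>f. D i (E j f))" for i j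
    using assms differential_operator_comp[of "D i" "E j"] by (simp add: unital_series_def)
  then have "differential_operator A (\<lambda>f. \<Sum>i\<le>n. D i (E (n - i) f))" for n
    by (rule differential_operator_sum)
  then show ?thesis
    using assms by (simp add: unital_series_def comp_series_def[abs_def])
qed

section \<open>Quotients and square roots constructed order by order\<close>

lemma unital_series_quotient:
  assumes "unital_series A S" "unital_series A T"
  shows "unital_series A (quotient_series S T)"
proof -
  have "differential_operator A (quotient_series S T n)" for n
  proof (induction n rule: less_induct)
    case (less n)
    have "differential_operator A (\<lambda>f. S i (quotient_series S T (n - i) f))" if "i \<in> {1..n}" for i
      using assms less[of "n - i"] that differential_operator_comp[of "S i" "quotient_series S T (n - i)"]
      by (simp add: unital_series_def)
    then have "differential_operator A (\<lambda>f. \<Sum>i\<in>{1..n}. S i (quotient_series S T (n - i) f))"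
      by (rule differential_operator_sum)
    then have "differential_operator A (\<lambda>f. T n f - (\<Sum>i\<in>{1..n}. S i (quotient_series S T (n - i) f)))"
      using assms(2) differential_operator_diff[of "T n"] by (simp add: unital_series_def)
    then show ?case
      by (simp only: quotient_series.simps[of S T n])
  qed
  moreover have "quotient_series S T 0 = (\<lambda>f. f)"
    using assms(2) by (subst quotient_series.simps) (simp add: unital_series_def)
  ultimately show ?thesis by (simp add: unital_series_def)
qed

lemma comp_quotient_series:
  assumes "unital_series A S"
  shows "comp_series S (quotient_series S T) = T"
proof (intro ext)
  fix n f p
  have "comp_series S (quotient_series S T) n f
      = quotient_series S T n f + (\<Sum>i\<in>{1..n}. S i (quotient_series S T (n - i) f))"
    using assms by (simp add: comp_series_def unital_series_def atMost_atLeast0 sum.atLeast_Suc_atMost)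
  then show "comp_series S (quotient_series S T) n f p = T n f p"
    by (simp add: quotient_series.simps[of S T n])
qed

lemma unital_series_root:
  assumes "unital_series A Q"
  shows "unital_series A (root_series Q)"
proof -
  have "differential_operator A (root_series Q n)" for n
  proof (induction n rule: less_induct)
    case (less n)
    have "differential_operator A (\<lambda>f. root_series Q i (root_series Q (n - i) f))" if "i \<in> {1..<n}" for i
      using less[of i] less[of "n - i"] that differential_operator_comp[of "root_series Q i" "root_series Q (n - i)"]
      by simp
    then have "differential_operator A (\<lambda>f. \<Sum>i\<in>{1..<n}. root_series Q i (root_series Q (n - i) f))"
      by (rule differential_operator_sum)
    then have "differential_operator A (\<lambda>f. Q n f - (\<Sum>i\<in>{1..<n}. root_series Q i (root_series Q (n - i) f)))"
      using assms differential_operator_diff[of "Q n"] by (simp add: unital_series_def)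
    from differential_operator_cmult[OF this, of "1/2"] show ?case
      by (simp only: root_series.simps[of Q n] differential_operator_id if_split) simp
  qed
  then show ?thesis by (simp add: unital_series_def root_series.simps[of Q 0])
qed

lemma comp_root_series:
  assumes "unital_series A Q"
  shows "comp_series (root_series Q) (root_series Q) = Q"
proof (intro ext)
  fix n f p
  show "comp_series (root_series Q) (root_series Q) n f p = Q n f p"
  proof (cases n)
    case 0
    then show ?thesis
      using assms by (simp add: comp_series_def root_series.simps[of Q 0] unital_series_def)
  next
    case (Suc k)
    \<comment> \<open>The end terms i = 0 and i = n of the square are both the n-th coefficient of
      the root. This is the origin of the factor 1/2 in the recursion.\<close>
    have "{..n} = insert 0 (insert n {1..<n})"
      using Suc by auto
    then have "comp_series (root_series Q) (root_series Q) n f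
        = root_series Q n f + root_series Q n f
          + (\<Sum>i\<in>{1..<n}. root_series Q i (root_series Q (n - i) f))"
      using Suc by (simp add: comp_series_def root_series.simps[of Q 0] add.assoc del: sum.op_ivl_Suc)
    then show ?thesis
      using Suc by (simp add: root_series.simps[of Q "Suc k"] diff_divide_distrib del: sum.op_ivl_Suc)
  qed
qed

section \<open>Conjugating series of operators by a twist\<close>

lemma unital_series_twist:
  assumes "real_involution s" "unital_series A D"
  shows "unital_series A (twist_series s D)"
proof -
  have "differential_operator A (\<lambda>f p. s (D i (\<lambda>q. s (f q)) p))" for i
    using assms differential_operator_conjugate[of "D i" s]
    by (simp add: unital_series_def real_involution_def)
  then have "differential_operator A (twist_series s D i)" for i
    unfolding twist_series_def[abs_def] by (rule differential_operator_cmult)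
  then show ?thesis
    using assms by (simp add: unital_series_def real_involution_def twist_series_def[abs_def])
qed

text \<open>Shows that J D J is again a formal series of differential operators. The signs pass
  through \<open>D i\<close> by complex linearity and through s by real linearity.\<close>

lemma formal_op_twist:
  assumes s: "real_involution s" and D: "\<And>i. differential_operator A (D i)" and f: "f \<in> formal_functions A"
  shows "formal_op (twist_series s D) f = formal_twist s (formal_op D (formal_twist s f))"
proof (intro fps_ext ext)
  fix n p
  have sm: "(\<lambda>q. s (fps_nth f i q)) \<in> smooth_functions A" for i
    using f s by (simp add: formal_functions_def real_involution_def smooth_functions_bounded_linear)
  have lin: "linear s"
    using s by (simp add: real_involution_def bounded_linear.linear)
  \<comment> \<open>The outer sign at order n and the inner one at order n - i combine to the sign
    of \<open>twist_series\<close>; i \<le> n rules out truncated subtraction.\<close>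
  have sign: "(-1) ^ n * ((-1) ^ (n - i) * z) = (-1) ^ i * (z::complex)" if "i \<le> n" for i z
  proof -
    have "(-1::complex) ^ n = (-1) ^ (n - i) * (-1) ^ i"
      using that by (simp flip: power_add)
    then show ?thesis
      by (simp add: mult.assoc mult.left_commute flip: power_mult_distrib)
  qed
  have "D i (\<lambda>q. (-1) ^ j * s (fps_nth f j q)) = (\<lambda>q. (-1) ^ j * D i (\<lambda>q. s (fps_nth f j q)) q)" for i j
    using differential_operator_apply_cmult[OF D sm] .
  then have "fps_nth (formal_twist s (formal_op D (formal_twist s f))) n p
      = (-1) ^ n * s (\<Sum>i\<le>n. (-1) ^ (n - i) * D i (\<lambda>q. s (fps_nth f (n - i) q)) p)"
    by (simp add: formal_twist_nth formal_op_def sum_fun_apply)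
  also have "\<dots> = (\<Sum>i\<le>n. (-1) ^ i * s (D i (\<lambda>q. s (fps_nth f (n - i) q)) p))"
    by (simp add: linear_sum[OF lin] real_involution_sign[OF s] sum_distrib_left sign)
  also have "\<dots> = fps_nth (formal_op (twist_series s D) f) n p"
    by (simp add: formal_op_def twist_series_def sum_fun_apply)
  finally show "fps_nth (formal_op (twist_series s D) f) n p
      = fps_nth (formal_twist s (formal_op D (formal_twist s f))) n p" ..
qed

text \<open>The construction of U is independent of d. The fourth conclusion lets an invariance
  already achieved for a second, commuting twist survive, so that two symmetrizations can be carried
  out in succession.\<close>

lemma symmetrized_equivalence:
  assumes S: "unital_series A S"
    and hom: "\<And>f g. f \<in> formal_functions A \<Longrightarrow> g \<in> formal_functions A \<Longrightarrow>
      formal_op S (star1 f g) = star2 (formal_op S f) (formal_op S g)"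
    and star: "formal_product star1" "formal_product star2"
    and s: "real_involution s"
    and anti1: "\<And>f g. f \<in> formal_functions A \<Longrightarrow> g \<in> formal_functions A \<Longrightarrow>
      formal_twist s (star1 (formal_twist s f) (formal_twist s g)) = star1 g f"
    and anti2: "\<And>f g. f \<in> formal_functions A \<Longrightarrow> g \<in> formal_functions A \<Longrightarrow>
      formal_twist s (star2 (formal_twist s f) (formal_twist s g)) = star2 g f"
  obtains U where "unital_series A U"
    and "\<And>f g. f \<in> formal_functions A \<Longrightarrow> g \<in> formal_functions A \<Longrightarrow>
      formal_op U (star1 f g) = star2 (formal_op U f) (formal_op U g)"
    and "\<And>f. f \<in> formal_functions A \<Longrightarrow> formal_twist s (formal_op U (formal_twist s f)) = formal_op U f"
    and "\<And>d f. \<lbrakk>real_involution d; \<And>z. s (d z) = d (s z);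
        \<And>f. f \<in> formal_functions A \<Longrightarrow> formal_twist d (formal_op S (formal_twist d f)) = formal_op S f;
        f \<in> formal_functions A\<rbrakk>
      \<Longrightarrow> formal_twist d (formal_op U (formal_twist d f)) = formal_op U f"
proof -
  \<comment> \<open>T is J S J, and b is the square root of the inverse of S followed by T, both as
    explicit series of differential operators.\<close>
  define T where "T = twist_series s S"
  define b where "b = root_series (quotient_series S T)"
  let ?J = "formal_twist s"
  have T: "unital_series A T"
    unfolding T_def by (rule unital_series_twist[OF s S])
  have b: "unital_series A b"
    unfolding b_def by (rule unital_series_root[OF unital_series_quotient[OF S T]])
  have ops: "differential_operator A (S i)" "differential_operator A (T i)" "differential_operator A (b i)" for i
    using S T b by (auto simp: unital_series_def)
  note near = near_identity_formal_op[OF S] near_identity_formal_op[OF T] near_identity_formal_op[OF b]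
  note closed = near[THEN near_identity_closed] formal_product_closed[OF star(1)]
    formal_product_closed[OF star(2)] formal_functions_twist
  note twist2 = formal_twist_twist[OF s]
  have T_eq: "formal_op T f = ?J (formal_op S (?J f))" if "f \<in> formal_functions A" for f
    unfolding T_def using formal_op_twist[OF s ops(1) that] .
  have Sbb: "formal_op S (formal_op b (formal_op b f)) = formal_op T f" if f: "f \<in> formal_functions A" for f
  proof -
    have Q: "unital_series A (quotient_series S T)"
      by (rule unital_series_quotient[OF S T])
    then have "formal_op b (formal_op b f) = formal_op (quotient_series S T) f"
      unfolding b_def by (subst formal_op_comp[OF ops(3)[unfolded b_def] ops(3)[unfolded b_def] f])
        (simp add: comp_root_series)
    then show ?thesis
      using formal_op_comp[of S "quotient_series S T"] ops(1) Q f
      by (simp add: comp_quotient_series[OF S] unital_series_def)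
  qed
  have T_hom: "formal_op T (star1 f g) = star2 (formal_op T f) (formal_op T g)"
    if fg: "f \<in> formal_functions A" "g \<in> formal_functions A" for f g
  proof -
    \<comment> \<open>J reverses factors in both products. Conjugating S by J reverses them twice,
      so T is multiplicative in the original order.\<close>
    have "?J (star1 f g) = star1 (?J g) (?J f)"
      using anti1[of "?J f" "?J g"] fg by (simp add: closed s twist2)
    then show ?thesis
      using fg anti2[of "?J (formal_op S (?J g))" "?J (formal_op S (?J f))"]
      by (simp add: T_eq closed s hom twist2)
  qed
  have "formal_op b (formal_op b (star1 f g))
      = star1 (formal_op b (formal_op b f)) (formal_op b (formal_op b g))"
    if "f \<in> formal_functions A" "g \<in> formal_functions A" for f g
    by (rule near_identity_inject[OF near(1)]) (simp_all add: that closed Sbb hom T_hom)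
  then have b_hom: "formal_op b (star1 f g) = star1 (formal_op b f) (formal_op b g)"
    if "f \<in> formal_functions A" "g \<in> formal_functions A" for f g
    using square_root_multiplicative[OF near(3) star(1)] that by blast
  define b' where "b' = twist_series s b"
  have b': "near_identity (formal_op b')"
    unfolding b'_def by (intro near_identity_formal_op unital_series_twist s b)
  have b'_eq: "formal_op b' f = ?J (formal_op b (?J f))" if "f \<in> formal_functions A" for f
    unfolding b'_def using formal_op_twist[OF s ops(3) that] .
  \<comment> \<open>With b' = J b J the inner twists cancel: T b' b' = J S b b J = J T J =
    S.\<close>
  have Tbb: "formal_op T (formal_op b' (formal_op b' f)) = formal_op S f" if f: "f \<in> formal_functions A" for f
    using f by (simp add: T_eq b'_eq closed s twist2 Sbb)
  have bb': "formal_op b (formal_op b' f) = f" if f: "f \<in> formal_functions A" for f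
  proof (rule square_root_inverse[OF near(3) b' _ f])
    fix f assume f: "f \<in> formal_functions A"
    \<comment> \<open>S b b b' b' = T b' b' = S, and S can be cancelled on the left.\<close>
    show "formal_op b (formal_op b (formal_op b' (formal_op b' f))) = f"
      by (rule near_identity_inject[OF near(1)])
        (simp_all add: f closed near_identity_closed[OF b'] Sbb Tbb)
  qed
  have U: "unital_series A (comp_series S b)"
    by (rule unital_series_comp[OF S b])
  have U_eq: "formal_op (comp_series S b) f = formal_op S (formal_op b f)" if "f \<in> formal_functions A" for f
    using formal_op_comp[of S b f] ops that by simp
  show ?thesis
  proof
    show "unital_series A (comp_series S b)" by (rule U)
    show "formal_op (comp_series S b) (star1 f g)
        = star2 (formal_op (comp_series S b) f) (formal_op (comp_series S b) g)"
      if "f \<in> formal_functions A" "g \<in> formal_functions A" for f g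
      using that by (simp add: U_eq closed b_hom hom)
    show "?J (formal_op (comp_series S b) (?J f)) = formal_op (comp_series S b) f"
      if f: "f \<in> formal_functions A" for f
    proof -
      have "?J (formal_op (comp_series S b) (?J f)) = formal_op T (formal_op b' f)"
        using f by (simp add: U_eq T_eq b'_eq closed s twist2)
      also have "\<dots> = formal_op S (formal_op b (formal_op b (formal_op b' f)))"
        using f by (simp add: Sbb near_identity_closed[OF b'])
      also have "\<dots> = formal_op (comp_series S b) f"
        using f by (simp add: bb' U_eq)
      finally show ?thesis .
    qed
    show "formal_twist d (formal_op (comp_series S b) (formal_twist d f)) = formal_op (comp_series S b) f"
      if d: "real_involution d" and sd: "\<And>z. s (d z) = d (s z)"
        and S_inv: "\<And>f. f \<in> formal_functions A \<Longrightarrow> formal_twist d (formal_op S (formal_twist d f)) = formal_op S f"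
        and f: "f \<in> formal_functions A" for d f
    proof -
      let ?K = "formal_twist d"
      note comm = formal_twist_commute[OF s d sd]
      note twist2' = formal_twist_twist[OF d]
      have S_inv': "?K (formal_op S f) = formal_op S (?K f)" if "f \<in> formal_functions A" for f
        using S_inv[of "?K f"] that d by (simp add: closed twist2')
      \<comment> \<open>K commutes with S by assumption and with J by \<open>comm\<close>, hence
        with T = J S J.\<close>
      have T_inv: "?K (formal_op T f) = formal_op T (?K f)" if "f \<in> formal_functions A" for f
        using that by (simp add: T_eq closed s d S_inv' flip: comm)
      define b'' where "b'' = twist_series d b"
      have b'': "near_identity (formal_op b'')"
        unfolding b''_def by (intro near_identity_formal_op unital_series_twist d b)
      have b''_eq: "formal_op b'' f = ?K (formal_op b (?K f))" if "f \<in> formal_functions A" for f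
        unfolding b''_def using formal_op_twist[OF d ops(3) that] .
      have "formal_op b f = formal_op b'' f"
      proof (rule square_root_unique[OF near(3) b'' _ f])
        fix f assume f: "f \<in> formal_functions A"
        show "formal_op b (formal_op b f) = formal_op b'' (formal_op b'' f)"
        proof (rule near_identity_inject[OF near(1)])
          \<comment> \<open>With b'' = K b K one has S b'' b'' = K S b b K = K T K = T = S b
            b.\<close>
          show "formal_op S (formal_op b (formal_op b f)) = formal_op S (formal_op b'' (formal_op b'' f))"
            using f by (simp add: b''_eq closed d twist2' Sbb T_inv flip: S_inv')
        qed (simp_all add: f closed near_identity_closed[OF b''])
      qed
      then have "?K (formal_op b (?K f)) = formal_op b f"
        using b''_eq[OF f] by simp
      then show ?thesis
        using f by (simp add: U_eq closed d S_inv')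
    qed
  qed
qed

section \<open>Translating between equivalence transformations and series of operators\<close>

lemma equivalence_transformation_formal_op:
  assumes "unital_series A D"
    and "\<And>f g. f \<in> formal_functions A \<Longrightarrow> g \<in> formal_functions A \<Longrightarrow>
      formal_op D (star1 f g) = star2 (formal_op D f) (formal_op D g)"
  shows "equivalence_transformation A star1 star2 (formal_op D)"
proof -
  have D: "\<And>i. differential_operator A (D i)" "D 0 = (\<lambda>f. f)"
    using assms(1) by (auto simp: unital_series_def)
  have "\<exists>E. (\<forall>i\<ge>1. differential_operator A (E i)) \<and>
      (\<forall>f\<in>formal_functions A. formal_op D f
        = Abs_fps (\<lambda>n. fps_nth f n + (\<Sum>i=1..n. E i (fps_nth f (n - i)))))"
    using D(1) formal_op_unital[of D, OF D(2)] by blast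
  then show ?thesis
    unfolding equivalence_transformation_def
    by (intro conjI ballI allI formal_op_closed formal_op_add formal_op_scale D(1) assms(2))
qed

lemma equivalence_transformation_series:
  assumes "equivalence_transformation A star1 star2 S"
    and star1: "formal_product star1"
  obtains D where "unital_series A D"
    and "\<And>f g. f \<in> formal_functions A \<Longrightarrow> g \<in> formal_functions A \<Longrightarrow>
      formal_op D (star1 f g) = star2 (formal_op D f) (formal_op D g)"
proof -
  obtain D where D: "\<forall>i\<ge>1. differential_operator A (D i)"
    "\<forall>f\<in>formal_functions A. S f = Abs_fps (\<lambda>n. fps_nth f n + (\<Sum>i=1..n. D i (fps_nth f (n - i))))"
    and hom: "\<forall>f\<in>formal_functions A. \<forall>g\<in>formal_functions A. S (star1 f g) = star2 (S f) (S g)"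
    using assms(1) unfolding equivalence_transformation_def by (elim conjE exE)
  \<comment> \<open>The sum in \<open>equivalence_transformation\<close> starts at i = 1 and leaves
    \<open>D 0\<close> unspecified; it is set to the identity here, which accounts for the separate
    leading term.\<close>
  define E where "E = D(0 := (\<lambda>f. f))"
  have "unital_series A E"
    using D(1) by (auto simp: E_def unital_series_def differential_operator_id)
  moreover have "formal_op E f = S f" if "f \<in> formal_functions A" for f
    using that D(2) by (simp add: formal_op_unital E_def)
  ultimately show ?thesis
    using that hom formal_product_closed[OF star1] by simp
qed

end

section \<open>Invariant equivalences for the three symmetry types\<close>

theorem proposition5p6:
  fixes A :: "('m::{t2_space,second_countable_topology}, 'e::euclidean_space) chart set"
    and \<omega> :: "'m two_form"
    and star1 star2 :: "('m \<Rightarrow> complex) fps \<Rightarrow> ('m \<Rightarrow> complex) fps \<Rightarrow> ('m \<Rightarrow> complex) fps"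
  assumes "symplectic_manifold A \<omega>"
    and "star_product A \<omega> star1"
    and "star_product A \<omega> star2"
    and "equivalent_star_products A star1 star2"
  shows "(conj_star_structure A star1 \<and> conj_star_structure A star2 \<longrightarrow>
            (\<exists>S. equivalence_transformation A star1 star2 S \<and> conj_invariant A S))
       \<and> (parity_property A star1 \<and> parity_property A star2 \<longrightarrow>
            (\<exists>S. equivalence_transformation A star1 star2 S \<and> parity_invariant A S))
       \<and> (weyl_type A star1 \<and> weyl_type A star2 \<longrightarrow>
            (\<exists>S. equivalence_transformation A star1 star2 S \<and> conj_invariant A S \<and> parity_invariant A S))"
proof -
  interpret smooth_manifold A
    using assms(1) by unfold_locales (simp add: symplectic_manifold_def)
  note star = star_product_imp_formal_product[OF assms(2)] star_product_imp_formal_product[OF assms(3)]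
  note structure_defs = conj_star_structure_def parity_property_def formal_conj_eq_twist formal_parity_eq_twist
  note invariant = conj_invariant_def parity_invariant_def formal_conj_eq_twist formal_parity_eq_twist
  obtain S0 where "equivalence_transformation A star1 star2 S0"
    using assms(4) unfolding equivalent_star_products_def ..
  then obtain S where S: "unital_series A S"
    "\<And>f g. f \<in> formal_functions A \<Longrightarrow> g \<in> formal_functions A \<Longrightarrow>
      formal_op S (star1 f g) = star2 (formal_op S f) (formal_op S g)"
    using equivalence_transformation_series star(1) by metis
  have conj: "\<exists>U. unital_series A U \<and>
      (\<forall>f\<in>formal_functions A. \<forall>g\<in>formal_functions A.
        formal_op U (star1 f g) = star2 (formal_op U f) (formal_op U g)) \<and>
      conj_invariant A (formal_op U)"
    if "conj_star_structure A star1" "conj_star_structure A star2"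
  proof (rule symmetrized_equivalence[OF S star real_involution_cnj])
    fix f g :: "('m \<Rightarrow> complex) fps" assume "f \<in> formal_functions A" "g \<in> formal_functions A"
    then show "formal_twist cnj (star1 (formal_twist cnj f) (formal_twist cnj g)) = star1 g f"
      "formal_twist cnj (star2 (formal_twist cnj f) (formal_twist cnj g)) = star2 g f"
      using that unfolding structure_defs by blast+
  next
    fix U assume "unital_series A U"
      "\<And>f g. f \<in> formal_functions A \<Longrightarrow> g \<in> formal_functions A \<Longrightarrow>
        formal_op U (star1 f g) = star2 (formal_op U f) (formal_op U g)"
      "\<And>f. f \<in> formal_functions A \<Longrightarrow> formal_twist cnj (formal_op U (formal_twist cnj f)) = formal_op U f"
    then show ?thesis
      unfolding invariant by blast
  qed
  \<comment> \<open>Stated for an arbitrary starting series D, since the Weyl case starts from an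
    already conjugation-invariant one; the final implication records that this invariance
    persists.\<close>
  have parity: "\<exists>U. unital_series A U \<and>
      (\<forall>f\<in>formal_functions A. \<forall>g\<in>formal_functions A.
        formal_op U (star1 f g) = star2 (formal_op U f) (formal_op U g)) \<and>
      parity_invariant A (formal_op U) \<and> (conj_invariant A (formal_op D) \<longrightarrow> conj_invariant A (formal_op U))"
    if "parity_property A star1" "parity_property A star2" and D: "unital_series A D"
      "\<And>f g. f \<in> formal_functions A \<Longrightarrow> g \<in> formal_functions A \<Longrightarrow>
        formal_op D (star1 f g) = star2 (formal_op D f) (formal_op D g)" for D
  proof (rule symmetrized_equivalence[OF D star real_involution_id])
    fix f g :: "('m \<Rightarrow> complex) fps" assume "f \<in> formal_functions A" "g \<in> formal_functions A"
    then show "formal_twist (\<lambda>z. z) (star1 (formal_twist (\<lambda>z. z) f) (formal_twist (\<lambda>z. z) g)) = star1 g f"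
      "formal_twist (\<lambda>z. z) (star2 (formal_twist (\<lambda>z. z) f) (formal_twist (\<lambda>z. z) g)) = star2 g f"
      using that(1,2) unfolding structure_defs by blast+
  next
    fix U assume U: "unital_series A U"
      "\<And>f g. f \<in> formal_functions A \<Longrightarrow> g \<in> formal_functions A \<Longrightarrow>
        formal_op U (star1 f g) = star2 (formal_op U f) (formal_op U g)"
      "\<And>f. f \<in> formal_functions A \<Longrightarrow>
        formal_twist (\<lambda>z. z) (formal_op U (formal_twist (\<lambda>z. z) f)) = formal_op U f"
      and inherit: "\<And>d f. \<lbrakk>real_involution d; \<And>z. d z = d z;
          \<And>f. f \<in> formal_functions A \<Longrightarrow> formal_twist d (formal_op D (formal_twist d f)) = formal_op D f;
          f \<in> formal_functions A\<rbrakk>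
        \<Longrightarrow> formal_twist d (formal_op U (formal_twist d f)) = formal_op U f"
    \<comment> \<open>Here s is the identity on complex numbers, so it commutes with conjugation by
      reflexivity.\<close>
    have "conj_invariant A (formal_op U)" if "conj_invariant A (formal_op D)"
      using inherit[OF real_involution_cnj refl] that unfolding invariant by blast
    then show ?thesis
      using U unfolding invariant by blast
  qed
  show ?thesis
    unfolding weyl_type_def
  proof (intro conjI impI)
    assume "conj_star_structure A star1 \<and> conj_star_structure A star2"
    then show "\<exists>S. equivalence_transformation A star1 star2 S \<and> conj_invariant A S"
      using conj equivalence_transformation_formal_op by blast
  next
    assume "parity_property A star1 \<and> parity_property A star2"
    then show "\<exists>S. equivalence_transformation A star1 star2 S \<and> parity_invariant A S"
      using parity[OF _ _ S] equivalence_transformation_formal_op by blast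
  next
    assume weyl: "(conj_star_structure A star1 \<and> parity_property A star1) \<and>
      (conj_star_structure A star2 \<and> parity_property A star2)"
    \<comment> \<open>Symmetrize with respect to C first; applying the parity construction to V then
      adds invariance under P without losing that under C.\<close>
    then obtain V where V: "unital_series A V"
      "\<And>f g. f \<in> formal_functions A \<Longrightarrow> g \<in> formal_functions A \<Longrightarrow>
        formal_op V (star1 f g) = star2 (formal_op V f) (formal_op V g)"
      "conj_invariant A (formal_op V)"
      using conj by blast
    then show "\<exists>S. equivalence_transformation A star1 star2 S \<and> conj_invariant A S \<and> parity_invariant A S"
      using parity[OF _ _ V(1,2)] weyl equivalence_transformation_formal_op by blast
  qed
qed

end
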